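(* Let $d\geq3$. There exists a constant $C>0$ depending on $d$ such that, for every $\tau>0$ and $\lambda=\tau^2$, $$\|f\|_{Y_\lambda^*}\leq C\|f\|_{\dot Y_\tau^{1/2}}$$ for all $f\in\mathcal{S}(\mathbb{R}^d)$.
   Context: $\widehat f(\xi) = (2\pi)^{-d/2}\int_{\mathbb{R}^d} e^{-ix\cdot\xi} f(x)\,\mathrm{d}x$. For $s\in\mathbb{R}$, $\|f\|_{\dot Y^s_\tau}=\||q_\tau|^s\widehat f\|_{L^2}$ with $q_\tau(\xi)=-|\xi|^2+2i\tau\xi_d+\tau^2$. $\mathbb{N}_0=\{0,1,2,\dots\}$; $D_0 = \{|x|\leq 1\}$, $D_j = \{2^{j-1}<|x|\leq 2^j\}$ for $j\geq 1$; $\|f\|_{B_*}=\sup_{j\in\mathbb{N}_0}2^{-j/2}\|f\|_{L^2(D_j)}$. Littlewood–Paley projectors: $\phi\in\mathcal{S}(\mathbb{R}^d)$ supported in $\{|\xi|\leq2\}$ with $\phi=1$ on $\{|\xi|\leq1\}$, $\psi(\xi)=\phi(\xi)-\phi(2\xi)$, $\widehat{P_kf}(\xi)=\psi(\xi/2^k)\widehat f(\xi)$, $\widehat{P_{\leq k}f}(\xi)=\phi(\xi/2^k)\widehat f(\xi)$. Given $\lambda>0$, $m_\lambda(\xi) = |\lambda - |\xi|^2|$, $k_\lambda\in\mathbb{Z}$ satisfies $2^{k_\lambda-1}<\lambda^{1/2}\leq2^{k_\lambda}$, $I=\{k_\lambda-2,k_\lambda-1,k_\lambda,k_\lambda+1\}$,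 $P_{<I}=P_{\leq k_\lambda-3}$, and $$\|u\|_{Y_\lambda^*}^2 = \|m_\lambda^{1/2}\widehat{P_{<I} u}\|_{L^2}^2 + \sum_{k\in I} \lambda^{1/2}\|P_k u\|_{B_*}^2 +\sum_{k > k_\lambda + 1}\|m_\lambda^{1/2}\widehat{P_k u}\|_{L^2}^2.$$ *)

theory Defs
  imports "HOL-Analysis.Analysis"
begin

text \<open>
  $\mathbb{R}^d$ is rendered as \<^typ>\<open>real ^ 'n\<close> with \<^term>\<open>CARD('n)\<close> in the role of $d$.  All norms take
  values in \<^typ>\<open>ennreal\<close>, so that an infinite integral, supremum or series has the value infinity
  and not a default value.
\<close>

definition ennsqrt :: "ennreal \<Rightarrow> ennreal" where
  "ennsqrt x = (if x = \<infinity> then \<infinity> else ennreal (sqrt (enn2real x)))"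

definition L2_norm_on :: "(real ^ 'n) set \<Rightarrow> (real ^ 'n \<Rightarrow> complex) \<Rightarrow> ennreal" where
  "L2_norm_on A f = ennsqrt (\<integral>\<^sup>+ x \<in> A. ennreal ((norm (f x))\<^sup>2) \<partial>lborel)"

definition partial_deriv :: "'n \<Rightarrow> (real ^ 'n \<Rightarrow> complex) \<Rightarrow> real ^ 'n \<Rightarrow> complex" where
  "partial_deriv i f x = frechet_derivative f (at x) (axis i 1)"

definition iter_partial :: "'n list \<Rightarrow> (real ^ 'n \<Rightarrow> complex) \<Rightarrow> real ^ 'n \<Rightarrow> complex" where
  "iter_partial is f = foldr partial_deriv is f"

text \<open>
  Smoothness is expressed by Frechet differentiability of every iterated partial derivative
  (so that all of them are continuous).
\<close>

definition schwartz_space :: "(real ^ 'n \<Rightarrow> complex) set" where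
  "schwartz_space = {f. \<forall>is. (\<forall>x. iter_partial is f differentiable (at x)) \<and>
     (\<forall>N::nat. \<exists>B::real. \<forall>x. norm x ^ N * norm (iter_partial is f x) \<le> B)}"

definition fourier :: "(real ^ 'n \<Rightarrow> complex) \<Rightarrow> real ^ 'n \<Rightarrow> complex" where
  "fourier f \<xi> = of_real ((2 * pi) powr (- real CARD('n) / 2)) *
     (LINT x|lborel. exp (- \<i> * of_real (x \<bullet> \<xi>)) * f x)"

definition inv_fourier :: "(real ^ 'n \<Rightarrow> complex) \<Rightarrow> real ^ 'n \<Rightarrow> complex" where
  "inv_fourier g x = of_real ((2 * pi) powr (- real CARD('n) / 2)) *
     (LINT \<xi>|lborel. exp (\<i> * of_real (x \<bullet> \<xi>)) * g \<xi>)"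

text \<open>The index \<open>e\<close> is the one of the distinguished coordinate $\xi_d$.\<close>

definition q_symbol :: "'n \<Rightarrow> real \<Rightarrow> real ^ 'n \<Rightarrow> complex" where
  "q_symbol e \<tau> \<xi> = - of_real ((norm \<xi>)\<^sup>2) + 2 * \<i> * of_real \<tau> * of_real (\<xi> $ e) + of_real (\<tau>\<^sup>2)"

definition Ydot_norm :: "'n \<Rightarrow> real \<Rightarrow> real \<Rightarrow> (real ^ 'n \<Rightarrow> complex) \<Rightarrow> ennreal" where
  "Ydot_norm e s \<tau> f =
     L2_norm_on UNIV (\<lambda>\<xi>. of_real (norm (q_symbol e \<tau> \<xi>) powr s) * fourier f \<xi>)"

definition D_set :: "nat \<Rightarrow> (real ^ 'n) set" where
  "D_set j = (if j = 0 then {x. norm x \<le> 1} else {x. 2 ^ (j - 1) < norm x \<and> norm x \<le> 2 ^ j})"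

definition B_star_norm :: "(real ^ 'n \<Rightarrow> complex) \<Rightarrow> ennreal" where
  "B_star_norm f = (SUP j::nat. ennreal (2 powr (- real j / 2)) * L2_norm_on (D_set j) f)"

text \<open>
  A Fourier multiplier \<open>T\<close> with symbol \<open>a\<close>, i.e. $\widehat{Tf} = a \widehat f$, is realised by the
  inverse Fourier transform.
\<close>

definition fourier_mult :: "(real ^ 'n \<Rightarrow> complex) \<Rightarrow> (real ^ 'n \<Rightarrow> complex) \<Rightarrow> real ^ 'n \<Rightarrow> complex" where
  "fourier_mult a f = inv_fourier (\<lambda>\<xi>. a \<xi> * fourier f \<xi>)"

definition LP_cutoff :: "(real ^ 'n \<Rightarrow> complex) \<Rightarrow> bool" where
  "LP_cutoff \<phi> \<longleftrightarrow> \<phi> \<in> schwartz_space \<and> closure {\<xi>. \<phi> \<xi> \<noteq> 0} \<subseteq> {\<xi>. norm \<xi> \<le> 2} \<and>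
     (\<forall>\<xi>. norm \<xi> \<le> 1 \<longrightarrow> \<phi> \<xi> = 1)"

definition LP_psi :: "(real ^ 'n \<Rightarrow> complex) \<Rightarrow> real ^ 'n \<Rightarrow> complex" where
  "LP_psi \<phi> \<xi> = \<phi> \<xi> - \<phi> (2 *\<^sub>R \<xi>)"

definition LP_proj :: "(real ^ 'n \<Rightarrow> complex) \<Rightarrow> int \<Rightarrow> (real ^ 'n \<Rightarrow> complex) \<Rightarrow> real ^ 'n \<Rightarrow> complex" where
  "LP_proj \<phi> k = fourier_mult (\<lambda>\<xi>. LP_psi \<phi> (\<xi> /\<^sub>R 2 powi k))"

definition LP_proj_le :: "(real ^ 'n \<Rightarrow> complex) \<Rightarrow> int \<Rightarrow> (real ^ 'n \<Rightarrow> complex) \<Rightarrow> real ^ 'n \<Rightarrow> complex" where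
  "LP_proj_le \<phi> k = fourier_mult (\<lambda>\<xi>. \<phi> (\<xi> /\<^sub>R 2 powi k))"

definition m_symbol :: "real \<Rightarrow> real ^ 'n \<Rightarrow> real" where
  "m_symbol lam \<xi> = \<bar>lam - (norm \<xi>)\<^sup>2\<bar>"

definition k_index :: "real \<Rightarrow> int" where
  "k_index lam = (THE k. 2 powi (k - 1) < sqrt lam \<and> sqrt lam \<le> 2 powi k)"

lemma k_index_unique:
  assumes "lam > 0"
  shows "\<exists>!k::int. 2 powi (k - 1) < sqrt lam \<and> sqrt lam \<le> 2 powi k"
proof -
  have "2 powi (k - 1) < sqrt lam \<and> sqrt lam \<le> 2 powi k \<longleftrightarrow> \<lceil>log 2 (sqrt lam)\<rceil> = k" for k :: int
  proof -
    have "2 powi i = 2 powr real_of_int i" for i :: int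
      by (simp add: powr_real_of_int')
    then show ?thesis
      using assms by (simp add: less_log_iff le_log_iff log_le_iff ceiling_eq_iff)
  qed
  then show ?thesis by simp
qed

definition weighted_L2 :: "real \<Rightarrow> (real ^ 'n \<Rightarrow> complex) \<Rightarrow> ennreal" where
  "weighted_L2 lam u = L2_norm_on UNIV (\<lambda>\<xi>. of_real (sqrt (m_symbol lam \<xi>)) * fourier u \<xi>)"

definition Y_star_norm :: "(real ^ 'n \<Rightarrow> complex) \<Rightarrow> real \<Rightarrow> (real ^ 'n \<Rightarrow> complex) \<Rightarrow> ennreal" where
  "Y_star_norm \<phi> lam u = (let \<kappa> = k_index lam in ennsqrt (
     (weighted_L2 lam (LP_proj_le \<phi> (\<kappa> - 3) u))\<^sup>2 +
     (\<Sum>k\<in>{\<kappa> - 2, \<kappa> - 1, \<kappa>, \<kappa> + 1}. ennreal (sqrt lam) * (B_star_norm (LP_proj \<phi> k u))\<^sup>2) +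
     (\<Sum>\<^sub>\<infinity>k\<in>{\<kappa> + 1<..}. (weighted_L2 lam (LP_proj \<phi> k u))\<^sup>2)))"

end

theory Submission
  imports Defs "HOL-Probability.Characteristic_Functions"
begin

text \<open>
  Write \<open>q\<close> for the symbol \<open>q_symbol e \<tau>\<close>, let \<open>\<lambda> = \<tau>\<^sup>2\<close>, and let \<open>N\<close> be the integral of
  \<open>\<bar>q\<bar>\<close> times the square of the Fourier transform of \<open>f\<close>, that is, the square of the right-hand
  norm.  All three parts of the left-hand norm are bounded by a constant times \<open>N\<close>.

  Since \<open>q = (\<tau>\<^sup>2 - \<bar>\<xi>\<bar>\<^sup>2) + 2 i \<tau> \<xi>\<^sub>e\<close>, the weight \<open>\<bar>\<tau>\<^sup>2 - \<bar>\<xi>\<bar>\<^sup>2\<bar>\<close> is at most \<open>\<bar>q\<bar>\<close>.  Together with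
  Fourier inversion (\<open>norm_fourier_inv_fourier_le\<close>) and the fact that at most three dyadic cutoffs
  overlap at a given frequency (\<open>LP_psi_overlap\<close>), this settles the low and the high frequencies.

  The frequencies comparable to \<open>\<tau>\<close> are the heart of the matter.  There \<open>q\<close> vanishes, on the
  codimension-two sphere \<open>\<bar>\<xi>\<bar> = \<tau>\<close>, \<open>\<xi>\<^sub>e = 0\<close>, and the claim is that a function \<open>u\<close> with Fourier
  transform \<open>g\<close> satisfies \<open>\<integral>\<^bsub>\<bar>x\<bar> \<le> R\<^esub> \<bar>u\<bar>\<^sup>2 \<le> C (R / \<tau>) \<integral> \<bar>q\<bar> \<bar>g\<bar>\<^sup>2\<close> for every \<open>R > 0\<close>.  Replace the
  indicator of the ball by a Gaussian of width \<open>R\<close>.  Multiplication by this Gaussian is, on the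
  Fourier side, convolution with the Gaussian probability density \<open>G\<close> of width \<open>\<sigma> = 1 / R\<close>
  (\<open>gaussian_smoothing\<close>), so the left-hand side is at most
  \<open>\<integral>\<integral> G(\<xi> - \<eta>) \<bar>g(\<xi>)\<bar> \<bar>g(\<eta>)\<bar>\<close> up to a constant (\<open>gaussian_energy_le\<close>).  The Schur test with weight
  \<open>\<bar>q\<bar>\<close> (\<open>weighted_schur_bound\<close>) reduces the claim to
  the pointwise estimate \<open>G * (1 / \<bar>q\<bar>) \<le> C / (\<tau> \<sigma>)\<close>, uniformly in all variables
  (\<open>gauss_average_inverse_q_symbol\<close>).

  This estimate is the averaged form of the codimension two of the zero set.  It follows from the
  geometric mean of the two bounds \<open>\<bar>q\<bar> \<ge> \<bar>\<tau>\<^sup>2 - \<bar>\<xi>\<bar>\<^sup>2\<bar>\<close> and \<open>\<bar>q\<bar> \<ge> 2 \<tau> \<bar>\<xi>\<^sub>e\<bar>\<close>: the reciprocal \<open>1 / \<bar>q\<bar>\<close> is at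
  most \<open>C / \<tau>\<close> times a sum of products \<open>\<bar>\<xi>\<^sub>e\<bar>\<^sup>-\<^sup>1\<^sup>/\<^sup>2 \<bar>\<xi>\<^sub>j - b\<bar>\<^sup>-\<^sup>1\<^sup>/\<^sup>2\<close>, where \<open>j \<noteq> e\<close> and \<open>b\<close> depends only on the
  coordinates other than \<open>\<xi>\<^sub>j\<close> (\<open>inverse_q_symbol_le\<close>).  Now \<open>G\<close> is a product of one-dimensional
  densities, and averaging \<open>\<bar>t - b\<bar>\<^sup>-\<^sup>1\<^sup>/\<^sup>2\<close> against a normal density of width \<open>\<sigma>\<close> costs at most
  \<open>5 \<sigma>\<^sup>-\<^sup>1\<^sup>/\<^sup>2\<close>, wherever \<open>b\<close> and the mean are (\<open>nn_integral_normal_density_rsqrt\<close>).  Integrating first in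
  \<open>\<xi>\<^sub>j\<close> and then in \<open>\<xi>\<^sub>e\<close> yields two such factors.
\<close>

section \<open>Lebesgue measure in coordinates\<close>

lemma prod_Basis_vec:
  fixes g :: "real ^ 'n \<Rightarrow> real"
  shows "(\<Prod>b\<in>Basis. g b) = (\<Prod>i\<in>UNIV. g (axis i 1))"
proof -
  have Basis: "(Basis :: (real ^ 'n) set) = (\<lambda>i. axis i 1) ` UNIV"
    by (auto simp: Basis_vec_def)
  have inj: "inj (\<lambda>i :: 'n. axis i (1 :: real))"
    by (auto simp: inj_def axis_eq_axis)
  show ?thesis unfolding Basis by (subst prod.reindex[OF inj]) simp
qed

lemma measurable_vec_lambda [measurable (raw)]:
  fixes f :: "'n::finite \<Rightarrow> 'a \<Rightarrow> real"
  assumes "\<And>i. f i \<in> borel_measurable M"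
  shows "(\<lambda>x. \<chi> i. f i x) \<in> borel_measurable M"
  using assms by (subst borel_measurable_euclidean_space) (auto simp: Basis_vec_def inner_axis)

lemma lborel_vec_eq_distr_PiM:
  "(lborel :: (real ^ 'n) measure) = distr (PiM UNIV (\<lambda>_. lborel)) borel (\<lambda>f. \<chi> i. f i)"
proof (rule lborel_eqI)
  interpret product_sigma_finite "\<lambda>_::'n. lborel :: real measure" ..
  fix l u :: "real ^ 'n"
  assume le: "\<And>b. b \<in> Basis \<Longrightarrow> l \<bullet> b \<le> u \<bullet> b"
  have le': "l $ i \<le> u $ i" for i
    using le[of "axis i 1"] by (simp add: inner_axis)
  have eq: "(\<lambda>f. \<chi> i. f i) -` box l u \<inter> space (PiM UNIV (\<lambda>_::'n. lborel :: real measure))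
      = PiE UNIV (\<lambda>i. {l $ i <..< u $ i})"
    by (auto simp: mem_box_cart space_PiM PiE_def Pi_def)
  have "emeasure (distr (PiM UNIV (\<lambda>_. lborel)) borel (\<lambda>f. \<chi> i. f i)) (box l u)
      = (\<Prod>i\<in>UNIV. emeasure lborel {l $ i <..< u $ i})"
    by (subst emeasure_distr) (simp_all add: eq emeasure_PiM)
  also have "\<dots> = ennreal (\<Prod>i\<in>UNIV. u $ i - l $ i)"
    using le' by (simp add: prod_ennreal)
  also have "(\<Prod>i\<in>UNIV. u $ i - l $ i) = (\<Prod>b\<in>Basis. (u - l) \<bullet> b)"
    by (simp add: prod_Basis_vec inner_axis)
  finally show "emeasure (distr (PiM UNIV (\<lambda>_. lborel)) borel (\<lambda>f. \<chi> i. f i)) (box l u)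
    = (\<Prod>b\<in>Basis. (u - l) \<bullet> b)" .
qed simp

lemma integral_vec_prod:
  fixes f :: "'n::finite \<Rightarrow> real \<Rightarrow> complex"
  assumes "\<And>i. integrable lborel (f i)"
  shows "integrable lborel (\<lambda>x :: real ^ 'n. \<Prod>i\<in>UNIV. f i (x $ i))"
    and "(LINT x|(lborel :: (real ^ 'n) measure). (\<Prod>i\<in>UNIV. f i (x $ i))) = (\<Prod>i\<in>UNIV. (LINT t|lborel. f i t))"
proof -
  interpret product_sigma_finite "\<lambda>_::'n. lborel :: real measure" ..
  have [measurable]: "f i \<in> borel_measurable borel" for i
    using assms[of i] by (simp add: integrable_iff_bounded)
  show "integrable lborel (\<lambda>x :: real ^ 'n. \<Prod>i\<in>UNIV. f i (x $ i))"
    by (subst lborel_vec_eq_distr_PiM, subst integrable_distr_eq)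
       (auto intro!: product_integrable_prod assms)
  show "(LINT x|(lborel :: (real ^ 'n) measure). (\<Prod>i\<in>UNIV. f i (x $ i))) = (\<Prod>i\<in>UNIV. (LINT t|lborel. f i t))"
    by (subst lborel_vec_eq_distr_PiM, subst integral_distr)
       (auto intro!: product_integral_prod assms)
qed

lemma nn_integral_vec_prod:
  fixes f :: "'n::finite \<Rightarrow> real \<Rightarrow> ennreal"
  assumes [measurable]: "\<And>i. f i \<in> borel_measurable borel"
  shows "(\<integral>\<^sup>+x. (\<Prod>i\<in>UNIV. f i (x $ i)) \<partial>(lborel :: (real ^ 'n) measure)) = (\<Prod>i\<in>UNIV. \<integral>\<^sup>+t. f i t \<partial>lborel)"
proof -
  interpret product_sigma_finite "\<lambda>_::'n. lborel :: real measure" ..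
  show ?thesis
    by (subst lborel_vec_eq_distr_PiM, subst nn_integral_distr)
       (auto intro!: product_nn_integral_prod)
qed

definition vec_upd :: "real ^ 'n \<Rightarrow> 'n \<Rightarrow> real \<Rightarrow> real ^ 'n" where
  "vec_upd x i t = (\<chi> k. if k = i then t else x $ k)"

lemma vec_upd_nth [simp]: "vec_upd x i t $ k = (if k = i then t else x $ k)"
  by (simp add: vec_upd_def)

lemma vec_upd_measurable [measurable (raw)]:
  assumes "f \<in> borel_measurable M" "g \<in> borel_measurable M"
  shows "(\<lambda>x. vec_upd (f x) i (g x)) \<in> borel_measurable M"
proof -
  have "(\<lambda>x. f x $ k) \<in> borel_measurable M" for k
    using borel_measurable_inner[OF assms(1) borel_measurable_const[of "axis k 1"]]
    by (simp add: inner_axis)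
  then show ?thesis
    unfolding vec_upd_def using assms(2) by (intro measurable_vec_lambda) auto
qed

text \<open>
  This is Tonelli's theorem in the form in which it is used below: to compare two integrals it is
  enough to compare them along every line parallel to one coordinate axis.  The product measure
  is hidden in the proof, so that later arguments can stay with vectors.
\<close>

lemma nn_integral_coordinate_mono:
  fixes F H :: "real ^ 'n \<Rightarrow> ennreal"
  assumes F [measurable]: "F \<in> borel_measurable borel" and H [measurable]: "H \<in> borel_measurable borel"
    and le: "\<And>x. (\<integral>\<^sup>+t. F (vec_upd x i t) \<partial>lborel) \<le> (\<integral>\<^sup>+t. H (vec_upd x i t) \<partial>lborel)"
  shows "(\<integral>\<^sup>+x. F x \<partial>lborel) \<le> (\<integral>\<^sup>+x. H x \<partial>lborel)"
proof -
  interpret product_sigma_finite "\<lambda>_::'n. lborel :: real measure" ..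
  have fubini: "(\<integral>\<^sup>+x. G x \<partial>lborel)
      = (\<integral>\<^sup>+f. (\<integral>\<^sup>+t. G (vec_upd (\<chi> k. f k) i t) \<partial>lborel) \<partial>PiM (UNIV - {i}) (\<lambda>_. lborel))"
    if [measurable]: "G \<in> borel_measurable borel" for G :: "real ^ 'n \<Rightarrow> ennreal"
  proof -
    have ins: "insert i (UNIV - {i}) = UNIV" by auto
    have "(\<integral>\<^sup>+x. G x \<partial>lborel) = (\<integral>\<^sup>+f. G (\<chi> k. f k) \<partial>PiM UNIV (\<lambda>_. lborel))"
      by (subst lborel_vec_eq_distr_PiM, subst nn_integral_distr) auto
    also have "\<dots> = (\<integral>\<^sup>+f. (\<integral>\<^sup>+t. G (\<chi> k. (f(i := t)) k) \<partial>lborel) \<partial>PiM (UNIV - {i}) (\<lambda>_. lborel))"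
      using product_nn_integral_insert[of "UNIV - {i}" i "\<lambda>f. G (\<chi> k. f k)"]
      unfolding ins by simp
    also have "(\<lambda>f t. G (\<chi> k. (f(i := t)) k)) = (\<lambda>f t. G (vec_upd (\<chi> k. f k) i t))"
      by (intro ext arg_cong[where f = G]) (auto simp: vec_eq_iff)
    finally show ?thesis .
  qed
  show ?thesis
    unfolding fubini[OF F] fubini[OF H] by (intro nn_integral_mono le)
qed

section \<open>Gaussians and their Fourier transform\<close>

text \<open>
  The centred Gaussian probability density of width \<open>\<sigma>\<close>.  The product form makes
  coordinatewise integration immediate.
\<close>

definition gauss_kernel :: "real \<Rightarrow> real ^ 'n \<Rightarrow> real" where
  "gauss_kernel \<sigma> z = (\<Prod>k\<in>UNIV. normal_density 0 \<sigma> (z $ k))"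

lemma gauss_kernel_measurable [measurable]: "gauss_kernel \<sigma> \<in> borel_measurable borel"
  unfolding gauss_kernel_def by measurable

lemma gauss_kernel_pos: "\<sigma> > 0 \<Longrightarrow> gauss_kernel \<sigma> z > 0"
  unfolding gauss_kernel_def by (intro prod_pos) (auto intro: normal_density_pos)

lemma gauss_kernel_nonneg [simp]: "gauss_kernel \<sigma> z \<ge> 0"
  unfolding gauss_kernel_def by (intro prod_nonneg) auto

lemma gauss_kernel_minus_commute: "gauss_kernel \<sigma> (x - y) = gauss_kernel \<sigma> (y - x)"
  unfolding gauss_kernel_def by (simp add: normal_density_def power2_commute)

text \<open>
  The characteristic function of the standard normal distribution, rescaled.
\<close>

lemma gauss_transform_real:
  assumes "\<sigma> > 0"
  shows "integrable lborel (\<lambda>t. iexp (t * z) * of_real (exp (- (\<sigma> * t)\<^sup>2 / 2)))"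
    and "(LINT t|lborel. iexp (t * z) * of_real (exp (- (\<sigma> * t)\<^sup>2 / 2)))
           = of_real (2 * pi * normal_density 0 \<sigma> z)"
proof -
  define h where "h s = iexp (s * (z / \<sigma>)) * complex_of_real (std_normal_density s)" for s
  have int: "integrable lborel h"
    unfolding h_def by (rule Bochner_Integration.integrable_bound[of _ "\<lambda>s. std_normal_density s"])
       (auto simp: norm_mult)
  have eq: "iexp (t * z) * of_real (exp (- (\<sigma> * t)\<^sup>2 / 2)) = of_real (sqrt (2 * pi)) * h (0 + \<sigma> * t)" for t
    using assms by (simp add: h_def std_normal_density_def)
  show "integrable lborel (\<lambda>t. iexp (t * z) * of_real (exp (- (\<sigma> * t)\<^sup>2 / 2)))"
    unfolding eq using assms by (intro integrable_mult_right lborel_integrable_real_affine int) simp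
  have "integral\<^sup>L lborel h = char std_normal_distribution (z / \<sigma>)"
    unfolding char_def h_def by (subst integral_density) (auto simp: scaleR_conv_of_real mult_ac)
  then have "integral\<^sup>L lborel h = of_real (exp (- (z / \<sigma>)\<^sup>2 / 2))"
    by (simp add: char_std_normal_distribution)
  moreover have "integral\<^sup>L lborel h = \<bar>\<sigma>\<bar> *\<^sub>R (LINT t|lborel. h (0 + \<sigma> * t))"
    using assms by (intro lborel_integral_real_affine) simp
  ultimately have *: "(LINT t|lborel. h (0 + \<sigma> * t)) = of_real (exp (- (z / \<sigma>)\<^sup>2 / 2) / \<sigma>)"
    using assms by (simp add: scaleR_conv_of_real field_simps)
  have "sqrt (2 * pi) * (exp (- (z / \<sigma>)\<^sup>2 / 2) / \<sigma>) = 2 * pi * normal_density 0 \<sigma> z"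
    using assms by (simp add: normal_density_def real_sqrt_mult power_divide field_simps)
  moreover have "(LINT t|lborel. iexp (t * z) * of_real (exp (- (\<sigma> * t)\<^sup>2 / 2)))
      = of_real (sqrt (2 * pi)) * (LINT t|lborel. h (0 + \<sigma> * t))"
    unfolding eq by simp
  ultimately show "(LINT t|lborel. iexp (t * z) * of_real (exp (- (\<sigma> * t)\<^sup>2 / 2)))
           = of_real (2 * pi * normal_density 0 \<sigma> z)"
    unfolding * by (simp only: flip: of_real_mult)
qed

lemma gauss_transform:
  fixes z :: "real ^ 'n"
  assumes "\<sigma> > 0"
  shows "integrable lborel (\<lambda>x :: real ^ 'n. iexp (x \<bullet> z) * of_real (exp (- (\<sigma> * norm x)\<^sup>2 / 2)))"
    and "(LINT x|lborel. iexp (x \<bullet> z) * of_real (exp (- (\<sigma> * norm x)\<^sup>2 / 2)))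
           = of_real ((2 * pi) ^ CARD('n) * gauss_kernel \<sigma> z)"
proof -
  have eq: "iexp (x \<bullet> z) * of_real (exp (- (\<sigma> * norm x)\<^sup>2 / 2))
     = (\<Prod>k\<in>UNIV. iexp (x $ k * z $ k) * of_real (exp (- (\<sigma> * x $ k)\<^sup>2 / 2)))" for x :: "real ^ 'n"
  proof -
    have "(\<Prod>k\<in>UNIV. iexp (x $ k * z $ k)) = iexp (x \<bullet> z)"
      by (simp add: inner_vec_def sum_distrib_left flip: exp_sum)
    moreover have "(norm x)\<^sup>2 = (\<Sum>k\<in>UNIV. (x $ k)\<^sup>2)"
      by (simp add: norm_vec_def L2_set_def sum_nonneg)
    then have "(\<Prod>k\<in>UNIV. exp (- (\<sigma> * x $ k)\<^sup>2 / 2)) = exp (- (\<sigma> * norm x)\<^sup>2 / 2)"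
      by (simp add: power_mult_distrib sum_distrib_left sum_negf sum_divide_distrib flip: exp_sum)
    ultimately show ?thesis
      by (simp add: prod.distrib flip: of_real_prod)
  qed
  show "integrable lborel (\<lambda>x :: real ^ 'n. iexp (x \<bullet> z) * of_real (exp (- (\<sigma> * norm x)\<^sup>2 / 2)))"
    unfolding eq by (rule integral_vec_prod) (rule gauss_transform_real[OF assms])
  show "(LINT x|lborel. iexp (x \<bullet> z) * of_real (exp (- (\<sigma> * norm x)\<^sup>2 / 2)))
           = of_real ((2 * pi) ^ CARD('n) * gauss_kernel \<sigma> z)"
    unfolding eq integral_vec_prod(2)[OF gauss_transform_real(1)[OF assms]]
      gauss_transform_real(2)[OF assms]
    by (simp add: gauss_kernel_def prod.distrib)
qed

lemma nn_integral_gauss_kernel: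
  fixes y :: "real ^ 'n"
  assumes "\<sigma> > 0"
  shows "(\<integral>\<^sup>+x. gauss_kernel \<sigma> (x - y) \<partial>lborel) = 1"
proof -
  have "(\<integral>\<^sup>+t. normal_density 0 \<sigma> (t - y $ k) \<partial>lborel) = 1" for k
  proof -
    have "(\<integral>\<^sup>+t. normal_density 0 \<sigma> (t - y $ k) \<partial>lborel) = (\<integral>\<^sup>+t. normal_density (y $ k) \<sigma> t \<partial>lborel)"
      by (simp add: normal_density_def)
    also have "\<dots> = ennreal (LINT t|lborel. normal_density (y $ k) \<sigma> t)"
      using assms by (intro nn_integral_eq_integral) auto
    finally show ?thesis using assms by simp
  qed
  then show ?thesis
    unfolding gauss_kernel_def
    by (simp add: nn_integral_vec_prod[of "\<lambda>k t. ennreal (normal_density 0 \<sigma> (t - y $ k))"] flip: prod_ennreal)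
qed

section \<open>Gaussian smoothing and Fourier inversion\<close>

text \<open>
  The integrability hypothesis of Fubini's theorem, for all the double integrals below.
\<close>

lemma integrable_pair_bound:
  fixes F :: "real ^ 'n \<Rightarrow> real ^ 'm \<Rightarrow> complex"
  assumes f: "integrable lborel f" and g: "integrable lborel g"
    and [measurable]: "case_prod F \<in> borel_measurable (borel \<Otimes>\<^sub>M borel)"
    and le: "\<And>x y. norm (F x y) \<le> norm (f x :: complex) * norm (g y :: complex)"
  shows "integrable (lborel \<Otimes>\<^sub>M lborel) (case_prod F)"
proof -
  have [measurable]: "f \<in> borel_measurable borel" "g \<in> borel_measurable borel"
    using f g by (simp_all add: integrable_iff_bounded)
  have "integrable (lborel \<Otimes>\<^sub>M lborel) (\<lambda>(x, y). f x * g y)"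
  proof (rule lborel_pair.Fubini_integrable)
    show "integrable lborel (\<lambda>x. LINT y|lborel. norm (case (x, y) of (x, y) \<Rightarrow> f x * g y))"
      using f by (simp add: norm_mult)
    show "AE x in lborel. integrable lborel (\<lambda>y. case (x, y) of (x, y) \<Rightarrow> f x * g y)"
      using g by simp
  qed measurable
  then show ?thesis
    by (rule Bochner_Integration.integrable_bound) (use le in \<open>auto simp: norm_mult\<close>)
qed

lemma integrable_gaussian:
  assumes "\<sigma> > 0"
  shows "integrable lborel (\<lambda>x :: real ^ 'n. complex_of_real (exp (- (\<sigma> * norm x)\<^sup>2 / 2)))"
  using gauss_transform(1)[OF assms, of 0] by simp

lemma inv_fourier_measurable [measurable]:
  assumes [measurable]: "g \<in> borel_measurable borel"
  shows "inv_fourier g \<in> borel_measurable borel"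
  unfolding inv_fourier_def by measurable

lemma norm_inv_fourier_le:
  fixes g :: "real ^ 'n \<Rightarrow> complex"
  shows "norm (inv_fourier g x) \<le> (2 * pi) powr (- real CARD('n) / 2) * (LINT \<xi>|lborel. norm (g \<xi>))"
proof -
  have "norm (LINT \<xi>|lborel. exp (\<i> * of_real (x \<bullet> \<xi>)) * g \<xi>)
      \<le> (LINT \<xi>|lborel. norm (exp (\<i> * of_real (x \<bullet> \<xi>)) * g \<xi>))"
    by (rule integral_norm_bound)
  then show ?thesis by (simp add: inv_fourier_def norm_mult mult_left_mono)
qed

text \<open>
  The transform of a product is the convolution of the transforms.  The Gaussian makes the double
  integral absolutely convergent even when \<open>inv_fourier g\<close> is not integrable.  Both the inversion
  theorem and the local energy bound rest on this identity.
\<close>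

lemma gaussian_smoothing:
  fixes g :: "real ^ 'n \<Rightarrow> complex"
  assumes \<sigma>: "\<sigma> > 0" and g: "integrable lborel g"
  shows "fourier (\<lambda>x. of_real (exp (- (\<sigma> * norm x)\<^sup>2 / 2)) * inv_fourier g x) \<xi>
    = (LINT \<eta>|lborel. of_real (gauss_kernel \<sigma> (\<xi> - \<eta>)) * g \<eta>)"
proof -
  \<comment> \<open>The two normalising factors cancel the factor of the Gaussian transform.\<close>
  define c where "c = (2 * pi) powr (- real CARD('n) / 2)"
  have c2: "c * c * (2 * pi) ^ CARD('n) = 1"
  proof -
    have "c * c = (2 * pi) powr (- real CARD('n))"
      unfolding c_def by (simp flip: powr_add)
    also have "\<dots> = inverse ((2 * pi) ^ CARD('n))"
      by (subst powr_minus) (simp add: powr_realpow)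
    finally have c2: "c * c = inverse ((2 * pi) ^ CARD('n))" .
    show ?thesis unfolding c2 by (rule left_inverse) simp
  qed
  have [measurable]: "g \<in> borel_measurable borel"
    using g by (simp add: integrable_iff_bounded)
  define F where "F x \<eta> = iexp (x \<bullet> (\<eta> - \<xi>)) * of_real (exp (- (\<sigma> * norm x)\<^sup>2 / 2)) * g \<eta>" for x \<eta> :: "real ^ 'n"
  have int: "integrable (lborel \<Otimes>\<^sub>M lborel) (case_prod F)"
  proof (rule integrable_pair_bound[OF integrable_gaussian[OF \<sigma>] g])
    show "case_prod F \<in> borel_measurable (borel \<Otimes>\<^sub>M borel)"
      unfolding F_def by measurable
    show "norm (F x y) \<le> norm (complex_of_real (exp (- (\<sigma> * norm x)\<^sup>2 / 2))) * norm (g y)" for x y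
      by (simp add: F_def norm_mult)
  qed
  have split: "exp (- \<i> * of_real (x \<bullet> \<xi>)) * iexp (x \<bullet> \<eta>) = iexp (x \<bullet> (\<eta> - \<xi>))" for x \<eta> :: "real ^ 'n"
    by (simp add: inner_diff_right algebra_simps flip: exp_add)
  have inner: "exp (- \<i> * of_real (x \<bullet> \<xi>)) * (of_real (exp (- (\<sigma> * norm x)\<^sup>2 / 2)) * inv_fourier g x)
      = of_real c * (LINT \<eta>|lborel. F x \<eta>)" for x :: "real ^ 'n"
  proof -
    have "F x \<eta> = (exp (- \<i> * of_real (x \<bullet> \<xi>)) * of_real (exp (- (\<sigma> * norm x)\<^sup>2 / 2)))
        * (iexp (x \<bullet> \<eta>) * g \<eta>)" for \<eta>
      unfolding F_def split[symmetric] by (simp only: mult_ac)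
    then have "(LINT \<eta>|lborel. F x \<eta>) = (exp (- \<i> * of_real (x \<bullet> \<xi>)) *
        of_real (exp (- (\<sigma> * norm x)\<^sup>2 / 2))) * (LINT \<eta>|lborel. iexp (x \<bullet> \<eta>) * g \<eta>)"
      by (simp only: integral_mult_right_zero)
    then show ?thesis by (simp add: inv_fourier_def c_def)
  qed
  have "fourier (\<lambda>x. of_real (exp (- (\<sigma> * norm x)\<^sup>2 / 2)) * inv_fourier g x) \<xi>
      = of_real (c * c) * (LINT x|lborel. LINT \<eta>|lborel. F x \<eta>)"
    unfolding fourier_def inner by (simp add: c_def)
  also have "(LINT x|lborel. LINT \<eta>|lborel. F x \<eta>) = (LINT \<eta>|lborel. LINT x|lborel. F x \<eta>)"
    by (rule lborel_pair.Fubini_integral[OF int, symmetric])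
  also have "(\<lambda>\<eta>. LINT x|lborel. F x \<eta>)
      = (\<lambda>\<eta>. of_real ((2 * pi) ^ CARD('n)) * (of_real (gauss_kernel \<sigma> (\<xi> - \<eta>)) * g \<eta>))"
    unfolding F_def using gauss_transform(2)[OF \<sigma>, where 'n = 'n]
    by (intro ext) (simp add: gauss_kernel_minus_commute[of \<sigma> \<xi>])
  also have "of_real (c * c) * (LINT \<eta>|lborel. of_real ((2 * pi) ^ CARD('n)) * (of_real (gauss_kernel \<sigma> (\<xi> - \<eta>)) * g \<eta>))
      = of_real (c * c * (2 * pi) ^ CARD('n)) * (LINT \<eta>|lborel. of_real (gauss_kernel \<sigma> (\<xi> - \<eta>)) * g \<eta>)"
    by simp
  finally show ?thesis unfolding c2 by simp
qed

lemma lborel_integral_affine: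
  fixes h :: "'a::euclidean_space \<Rightarrow> complex"
  assumes [measurable]: "h \<in> borel_measurable borel" and c: "c \<noteq> 0"
  shows "(LINT x|lborel. h x) = (LINT x|lborel. of_real (\<bar>c\<bar> ^ DIM('a)) * h (t + c *\<^sub>R x))"
  by (subst lborel_affine[OF c, of t], subst integral_density)
     (auto simp: integral_distr scaleR_conv_of_real)

lemma integrable_gauss_kernel:
  assumes "\<sigma> > 0"
  shows "integrable lborel (gauss_kernel \<sigma> :: real ^ 'n \<Rightarrow> real)" "(LINT x|lborel. gauss_kernel \<sigma> (x :: real ^ 'n)) = 1"
proof -
  have "(\<integral>\<^sup>+x. gauss_kernel \<sigma> (x :: real ^ 'n) \<partial>lborel) = ennreal 1"
    using nn_integral_gauss_kernel[OF assms, where y = "0 :: real ^ 'n"] by simp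
  then have "has_bochner_integral lborel (gauss_kernel \<sigma> :: real ^ 'n \<Rightarrow> real) 1"
    by (intro has_bochner_integral_nn_integral) auto
  then show "integrable lborel (gauss_kernel \<sigma> :: real ^ 'n \<Rightarrow> real)"
    "(LINT x|lborel. gauss_kernel \<sigma> (x :: real ^ 'n)) = 1"
    by (auto simp: has_bochner_integral_iff)
qed

lemma gauss_kernel_scaleR:
  fixes z :: "real ^ 'n"
  assumes "\<sigma> > 0"
  shows "\<sigma> ^ CARD('n) * gauss_kernel \<sigma> (\<sigma> *\<^sub>R z) = gauss_kernel 1 z"
proof -
  have "\<sigma> * normal_density 0 \<sigma> (\<sigma> * t) = normal_density 0 1 t" for t
    using assms by (simp add: normal_density_def real_sqrt_mult power_mult_distrib)
  then have "(\<Prod>k\<in>UNIV. \<sigma> * normal_density 0 \<sigma> (\<sigma> * z $ k)) = (\<Prod>k\<in>UNIV. normal_density 0 1 (z $ k))"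
    by simp
  then show ?thesis by (simp add: gauss_kernel_def prod.distrib)
qed

text \<open>
  Insert the factor \<open>exp (- (\<sigma> \<bar>x\<bar>)\<^sup>2 / 2)\<close> and let \<open>\<sigma>\<close> tend to \<open>0\<close>.  On the one hand the transforms
  converge to that of \<open>inv_fourier g\<close>; on the other hand they are averages of \<open>g\<close> against an approximate identity.
\<close>

lemma fourier_inv_fourier:
  fixes g :: "real ^ 'n \<Rightarrow> complex"
  assumes g: "integrable lborel g" and cont: "continuous_on UNIV g" and bdd: "\<And>x. norm (g x) \<le> B"
    and u: "integrable lborel (inv_fourier g)"
  shows "fourier (inv_fourier g) \<xi> = g \<xi>"
proof -
  have [measurable]: "g \<in> borel_measurable borel"
    using g by (simp add: integrable_iff_bounded)
  define \<sigma> where "\<sigma> n = inverse (real (Suc n))" for n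
  have \<sigma>: "\<sigma> n > 0" for n by (simp add: \<sigma>_def)
  have \<sigma>0: "\<sigma> \<longlonglongrightarrow> 0" unfolding \<sigma>_def by (rule LIMSEQ_inverse_real_of_nat) 
  let ?I = "\<lambda>n. fourier (\<lambda>x. of_real (exp (- (\<sigma> n * norm x)\<^sup>2 / 2)) * inv_fourier g x) \<xi>"
  have "?I \<longlonglongrightarrow> fourier (inv_fourier g) \<xi>"
    unfolding fourier_def
  proof (intro tendsto_mult tendsto_const integral_dominated_convergence[where w = "\<lambda>x. norm (inv_fourier g x)"])
    show "AE x in lborel. (\<lambda>n. exp (- \<i> * of_real (x \<bullet> \<xi>)) * (of_real (exp (- (\<sigma> n * norm x)\<^sup>2 / 2)) * inv_fourier g x))
        \<longlonglongrightarrow> exp (- \<i> * of_real (x \<bullet> \<xi>)) * inv_fourier g x"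
    proof (intro AE_I2)
      fix x :: "real ^ 'n"
      have "(\<lambda>n. exp (- \<i> * of_real (x \<bullet> \<xi>)) * (of_real (exp (- (\<sigma> n * norm x)\<^sup>2 / 2)) * inv_fourier g x))
        \<longlonglongrightarrow> exp (- \<i> * of_real (x \<bullet> \<xi>)) * (of_real (exp (- (0 * norm x)\<^sup>2 / 2)) * inv_fourier g x)"
        by (intro tendsto_intros \<sigma>0) simp_all
      then show "(\<lambda>n. exp (- \<i> * of_real (x \<bullet> \<xi>)) * (of_real (exp (- (\<sigma> n * norm x)\<^sup>2 / 2)) * inv_fourier g x))
        \<longlonglongrightarrow> exp (- \<i> * of_real (x \<bullet> \<xi>)) * inv_fourier g x" by simp
    qed
    show "AE x in lborel. norm (exp (- \<i> * of_real (x \<bullet> \<xi>)) * (of_real (exp (- (\<sigma> n * norm x)\<^sup>2 / 2)) * inv_fourier g x))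
        \<le> norm (inv_fourier g x)" for n
      by (intro AE_I2) (auto simp: norm_mult mult_left_le_one_le)
  qed (use u in auto)
  moreover have "?I \<longlonglongrightarrow> g \<xi>"
  proof -
    \<comment> \<open>The substitution \<open>\<eta> = \<xi> - \<sigma> z\<close> moves the parameter from the kernel into \<open>g\<close>.\<close>
    have eq: "?I n = (LINT z|lborel. of_real (gauss_kernel 1 z) * g (\<xi> - \<sigma> n *\<^sub>R z))" for n
    proof -
      have "?I n = (LINT \<eta>|lborel. of_real (gauss_kernel (\<sigma> n) (\<xi> - \<eta>)) * g \<eta>)"
        by (rule gaussian_smoothing[OF \<sigma> g])
      also have "\<dots> = (LINT z|lborel. of_real (\<bar>- \<sigma> n\<bar> ^ CARD('n)) *
          (of_real (gauss_kernel (\<sigma> n) (\<xi> - (\<xi> + (- \<sigma> n) *\<^sub>R z))) * g (\<xi> + (- \<sigma> n) *\<^sub>R z)))"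
        using \<sigma>[of n] by (subst lborel_integral_affine[of _ "- \<sigma> n" \<xi>]) auto
      also have "\<dots> = (LINT z|lborel. of_real (gauss_kernel 1 z) * g (\<xi> - \<sigma> n *\<^sub>R z))"
      proof (intro Bochner_Integration.integral_cong refl)
        fix z :: "real ^ 'n"
        have "gauss_kernel (\<sigma> n) (- (\<sigma> n *\<^sub>R z)) = gauss_kernel (\<sigma> n) (\<sigma> n *\<^sub>R z)"
          using gauss_kernel_minus_commute[of "\<sigma> n" 0 "\<sigma> n *\<^sub>R z"] by simp
        then show "of_real (\<bar>- \<sigma> n\<bar> ^ CARD('n)) *
            (of_real (gauss_kernel (\<sigma> n) (\<xi> - (\<xi> + (- \<sigma> n) *\<^sub>R z))) * g (\<xi> + (- \<sigma> n) *\<^sub>R z))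
          = of_real (gauss_kernel 1 z) * g (\<xi> - \<sigma> n *\<^sub>R z)"
          using \<sigma>[of n] unfolding gauss_kernel_scaleR[OF \<sigma>[of n], symmetric] by simp
      qed
      finally show ?thesis .
    qed
    have "(\<lambda>n. LINT z|lborel. of_real (gauss_kernel 1 z) * g (\<xi> - \<sigma> n *\<^sub>R z))
        \<longlonglongrightarrow> (LINT z|(lborel :: (real ^ 'n) measure). of_real (gauss_kernel 1 z) * g \<xi>)"
    proof (intro integral_dominated_convergence[where w = "\<lambda>z. gauss_kernel 1 z * B"])
      show "AE z in lborel. (\<lambda>n. of_real (gauss_kernel 1 z) * g (\<xi> - \<sigma> n *\<^sub>R z))
          \<longlonglongrightarrow> of_real (gauss_kernel 1 z) * g \<xi>"
      proof (intro AE_I2 tendsto_mult tendsto_const)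
        fix z :: "real ^ 'n"
        have "(\<lambda>n. \<xi> - \<sigma> n *\<^sub>R z) \<longlonglongrightarrow> \<xi> - 0 *\<^sub>R z"
          by (intro tendsto_intros \<sigma>0)
        moreover have "isCont g (\<xi> - 0 *\<^sub>R z)"
          using cont by (simp add: continuous_on_eq_continuous_at)
        ultimately have "(\<lambda>n. g (\<xi> - \<sigma> n *\<^sub>R z)) \<longlonglongrightarrow> g (\<xi> - 0 *\<^sub>R z)"
          by (metis isCont_tendsto_compose)
        then show "(\<lambda>n. g (\<xi> - \<sigma> n *\<^sub>R z)) \<longlonglongrightarrow> g \<xi>" by simp
      qed
      show "AE z in lborel. norm (of_real (gauss_kernel 1 z) * g (\<xi> - \<sigma> n *\<^sub>R z)) \<le> gauss_kernel 1 z * B" for n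
        by (intro AE_I2) (auto simp: norm_mult intro!: mult_mono bdd)
      show "integrable lborel (\<lambda>z :: real ^ 'n. gauss_kernel 1 z * B)"
        using integrable_gauss_kernel(1)[of 1, where 'n = 'n] by simp
    qed measurable
    also have "(LINT z|(lborel :: (real ^ 'n) measure). of_real (gauss_kernel 1 z) * g \<xi>) = g \<xi>"
      using integrable_gauss_kernel[of 1, where 'n = 'n] by simp
    finally show ?thesis unfolding eq .
  qed
  ultimately show ?thesis by (rule LIMSEQ_unique)
qed

text \<open>
  The Bochner integral of a function that is not integrable is \<open>0\<close>, and multiplication by a
  character does not affect integrability.
\<close>

lemma fourier_not_integrable:
  assumes "\<not> integrable lborel f"
  shows "fourier f \<xi> = 0"
proof -
  have "\<not> integrable lborel (\<lambda>x. exp (- \<i> * of_real (x \<bullet> \<xi>)) * f x)"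
  proof
    assume int: "integrable lborel (\<lambda>x. exp (- \<i> * of_real (x \<bullet> \<xi>)) * f x)"
    have "(\<lambda>x. exp (\<i> * of_real (x \<bullet> \<xi>)) * (exp (- \<i> * of_real (x \<bullet> \<xi>)) * f x)) = f"
      by (simp add: mult.assoc[symmetric] flip: exp_add)
    moreover have "integrable lborel (\<lambda>x. exp (\<i> * of_real (x \<bullet> \<xi>)) * (exp (- \<i> * of_real (x \<bullet> \<xi>)) * f x))"
      by (rule Bochner_Integration.integrable_bound[OF int])
         (use borel_measurable_integrable[OF int] in \<open>auto simp: norm_mult\<close>)
    ultimately show False using assms by simp
  qed
  then show ?thesis by (simp add: fourier_def not_integrable_integral_eq)
qed

text \<open>
  An inequality suffices for upper bounds, and unlike the equality it holds without
  decay of \<open>inv_fourier g\<close>: either the inversion theorem applies or the left-hand side is \<open>0\<close>.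
\<close>

lemma norm_fourier_inv_fourier_le:
  fixes g :: "real ^ 'n \<Rightarrow> complex"
  assumes g: "integrable lborel g" and cont: "continuous_on UNIV g" and bdd: "\<And>x. norm (g x) \<le> B"
  shows "norm (fourier (inv_fourier g) \<xi>) \<le> norm (g \<xi>)"
proof (cases "integrable lborel (inv_fourier g)")
  case True
  then show ?thesis using fourier_inv_fourier[OF assms] by simp
next
  case False
  then show ?thesis by (simp add: fourier_not_integrable)
qed

text \<open>
  With \<open>u = inv_fourier g\<close> and \<open>v\<close> the product of \<open>u\<close> with the Gaussian, the left-hand side is the inner
  product of \<open>u\<close> and \<open>v\<close>.  Moving the transform from one factor to the other turns it into the inner product
  of \<open>g\<close> with the transform of \<open>v\<close>, which is a Gaussian average of \<open>g\<close> by \<open>gaussian_smoothing\<close>.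
\<close>

lemma gaussian_energy_le:
  fixes g :: "real ^ 'n \<Rightarrow> complex"
  assumes \<sigma>: "\<sigma> > 0" and g: "integrable lborel g"
  shows "(\<integral>\<^sup>+x. ennreal (exp (- (\<sigma> * norm x)\<^sup>2 / 2) * (norm (inv_fourier g x))\<^sup>2) \<partial>lborel)
    \<le> (\<integral>\<^sup>+\<xi>. \<integral>\<^sup>+\<eta>. ennreal (gauss_kernel \<sigma> (\<xi> - \<eta>) * (norm (g \<xi>) * norm (g \<eta>))) \<partial>lborel \<partial>lborel)"
proof -
  have [measurable]: "g \<in> borel_measurable borel"
    using g by (simp add: integrable_iff_bounded)
  define c where "c = (2 * pi) powr (- real CARD('n) / 2)"
  define \<gamma> where "\<gamma> x = exp (- (\<sigma> * norm x)\<^sup>2 / 2)" for x :: "real ^ 'n"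
  define u where "u = inv_fourier g"
  define v where "v x = of_real (\<gamma> x) * u x" for x
  have [measurable]: "\<gamma> \<in> borel_measurable borel" "u \<in> borel_measurable borel" "v \<in> borel_measurable borel"
    unfolding \<gamma>_def u_def v_def by measurable
  obtain B where B: "norm (u x) \<le> B" for x
    using norm_inv_fourier_le[of g] unfolding u_def by blast
  have \<gamma>: "integrable lborel (\<lambda>x. complex_of_real (\<gamma> x))"
    unfolding \<gamma>_def by (rule integrable_gaussian[OF \<sigma>])
  have v: "integrable lborel v"
  proof (rule Bochner_Integration.integrable_bound)
    show "integrable lborel (\<lambda>x. complex_of_real (\<gamma> x) * of_real B)" using \<gamma> by simp
    show "AE x in lborel. norm (v x) \<le> norm (complex_of_real (\<gamma> x) * of_real B)"
      using B by (intro AE_I2) (auto simp: v_def norm_mult intro!: mult_left_mono order_trans[OF B])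
  qed measurable
  have [measurable]: "(\<lambda>x. cnj (v x)) \<in> borel_measurable borel"
    by (rule measurable_compose[of v borel borel cnj])
       (auto intro: borel_measurable_continuous_onI continuous_on_cnj)
  have vu: "integrable lborel (\<lambda>x. cnj (v x) * u x)"
  proof (rule Bochner_Integration.integrable_bound)
    show "integrable lborel (\<lambda>x. v x * of_real B)" using v by simp
    show "AE x in lborel. norm (cnj (v x) * u x) \<le> norm (v x * of_real B)"
      using B by (intro AE_I2) (auto simp: norm_mult intro!: mult_left_mono order_trans[OF B])
  qed measurable
  have sq: "cnj (v x) * u x = of_real (\<gamma> x * (norm (u x))\<^sup>2)" for x
    using complex_norm_square[of "u x"] by (simp add: v_def mult_ac)
  define F where "F x \<xi> = cnj (v x) * (iexp (x \<bullet> \<xi>) * g \<xi>)" for x \<xi>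
  have int: "integrable (lborel \<Otimes>\<^sub>M lborel) (case_prod F)"
  proof (rule integrable_pair_bound[OF v g])
    show "case_prod F \<in> borel_measurable (borel \<Otimes>\<^sub>M borel)"
      unfolding F_def by measurable
  qed (simp add: F_def norm_mult)
  have "(LINT \<xi>|lborel. F x \<xi>) = cnj (v x) * (LINT \<xi>|lborel. iexp (x \<bullet> \<xi>) * g \<xi>)" for x
    unfolding F_def by (rule integral_mult_right_zero)
  then have "cnj (v x) * u x = of_real c * (LINT \<xi>|lborel. F x \<xi>)" for x
    by (simp add: u_def inv_fourier_def c_def)
  then have "(LINT x|lborel. cnj (v x) * u x) = of_real c * (LINT x|lborel. LINT \<xi>|lborel. F x \<xi>)"
    by simp
  also have "(LINT x|lborel. LINT \<xi>|lborel. F x \<xi>) = (LINT \<xi>|lborel. LINT x|lborel. F x \<xi>)"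
    by (rule lborel_pair.Fubini_integral[OF int, symmetric])
  also have "of_real c * \<dots> = (LINT \<xi>|lborel. g \<xi> * cnj (fourier v \<xi>))"
  proof -
    have "of_real c * (LINT x|lborel. F x \<xi>) = g \<xi> * cnj (fourier v \<xi>)" for \<xi>
    proof -
      have "cnj (fourier v \<xi>) = of_real c * (LINT x|lborel. cnj (exp (- \<i> * of_real (x \<bullet> \<xi>)) * v x))"
        unfolding fourier_def c_def complex_cnj_mult[of "of_real _"] by (simp only: complex_cnj_complex_of_real Bochner_Integration.integral_cnj)
      also have "(\<lambda>x. cnj (exp (- \<i> * of_real (x \<bullet> \<xi>)) * v x)) = (\<lambda>x. iexp (x \<bullet> \<xi>) * cnj (v x))"
        by (simp add: exp_cnj)
      finally show ?thesis by (simp add: F_def mult_ac)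
    qed
    then show ?thesis by (simp flip: integral_mult_right_zero)
  qed
  also have "fourier v = (\<lambda>\<xi>. LINT \<eta>|lborel. of_real (gauss_kernel \<sigma> (\<xi> - \<eta>)) * g \<eta>)"
    unfolding v_def \<gamma>_def u_def by (intro ext gaussian_smoothing[OF \<sigma> g])
  finally have E: "(LINT x|lborel. cnj (v x) * u x)
    = (LINT \<xi>|lborel. g \<xi> * cnj (LINT \<eta>|lborel. of_real (gauss_kernel \<sigma> (\<xi> - \<eta>)) * g \<eta>))" .
  have nb: "ennreal (norm (integral\<^sup>L lborel h)) \<le> (\<integral>\<^sup>+x. ennreal (norm (h x)) \<partial>lborel)"
    for h :: "real ^ 'n \<Rightarrow> complex"
    by (cases "integrable lborel h") (auto intro: integral_norm_bound_ennreal simp: not_integrable_integral_eq)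
  have "(\<integral>\<^sup>+x. ennreal (\<gamma> x * (norm (u x))\<^sup>2) \<partial>lborel) = (\<integral>\<^sup>+x. ennreal (norm (cnj (v x) * u x)) \<partial>lborel)"
    unfolding sq norm_of_real by (simp add: \<gamma>_def)
  also have "\<dots> = ennreal (LINT x|lborel. norm (cnj (v x) * u x))"
    using vu by (intro nn_integral_eq_integral) auto
  also have "\<dots> = ennreal (norm (LINT x|lborel. cnj (v x) * u x))"
    unfolding sq integral_complex_of_real norm_of_real by (simp add: \<gamma>_def integral_nonneg)
  also have "\<dots> \<le> (\<integral>\<^sup>+\<xi>. ennreal (norm (g \<xi> * cnj (LINT \<eta>|lborel. of_real (gauss_kernel \<sigma> (\<xi> - \<eta>)) * g \<eta>))) \<partial>lborel)"
    unfolding E by (rule nb)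
  also have "\<dots> \<le> (\<integral>\<^sup>+\<xi>. \<integral>\<^sup>+\<eta>. ennreal (gauss_kernel \<sigma> (\<xi> - \<eta>) * (norm (g \<xi>) * norm (g \<eta>))) \<partial>lborel \<partial>lborel)"
  proof (rule nn_integral_mono)
    fix \<xi>
    have "ennreal (norm (g \<xi> * cnj (LINT \<eta>|lborel. of_real (gauss_kernel \<sigma> (\<xi> - \<eta>)) * g \<eta>)))
        \<le> ennreal (norm (g \<xi>)) * (\<integral>\<^sup>+\<eta>. ennreal (norm (of_real (gauss_kernel \<sigma> (\<xi> - \<eta>)) * g \<eta>)) \<partial>lborel)"
      by (subst norm_mult, subst ennreal_mult) (simp_all del: norm_mult add: mult_left_mono nb)
    also have "\<dots> = (\<integral>\<^sup>+\<eta>. ennreal (norm (g \<xi>)) * ennreal (norm (of_real (gauss_kernel \<sigma> (\<xi> - \<eta>)) * g \<eta>)) \<partial>lborel)"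
      by (simp add: nn_integral_cmult)
    also have "\<dots> = (\<integral>\<^sup>+\<eta>. ennreal (gauss_kernel \<sigma> (\<xi> - \<eta>) * (norm (g \<xi>) * norm (g \<eta>))) \<partial>lborel)"
      by (simp add: norm_mult mult_ac flip: ennreal_mult)
    finally show "ennreal (norm (g \<xi> * cnj (LINT \<eta>|lborel. of_real (gauss_kernel \<sigma> (\<xi> - \<eta>)) * g \<eta>)))
        \<le> (\<integral>\<^sup>+\<eta>. ennreal (gauss_kernel \<sigma> (\<xi> - \<eta>) * (norm (g \<xi>) * norm (g \<eta>))) \<partial>lborel)" .
  qed
  finally show ?thesis unfolding \<gamma>_def u_def .
qed

section \<open>Gaussian averages of inverse square roots\<close>

text \<open>
  The values lie in \<^typ>\<open>ennreal\<close> so that the value at \<open>0\<close> is infinite.  Real division would give \<open>0\<close>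
  there, and the pointwise bounds below would fail on the singular set.
\<close>

definition rsqrt :: "real \<Rightarrow> ennreal" where
  "rsqrt t = inverse (ennreal (sqrt \<bar>t\<bar>))"

lemma rsqrt_measurable [measurable]: "rsqrt \<in> borel_measurable borel"
  unfolding rsqrt_def by measurable

lemma inverse_ennreal_antimono: "a \<le> b \<Longrightarrow> inverse b \<le> inverse (a :: ennreal)"
proof (cases "a = 0 \<or> b = top")
  case False
  assume "a \<le> b"
  with False show ?thesis
    by (cases a; cases b) (auto simp: inverse_ennreal top_unique ennreal_eq_0_iff not_le)
qed auto

lemma nn_integral_rsqrt_le:
  assumes "\<sigma> \<ge> 0"
  shows "(\<integral>\<^sup>+t. rsqrt t * indicator {-\<sigma>..\<sigma>} t \<partial>lborel) \<le> ennreal (4 * sqrt \<sigma>)"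
proof -
  let ?f = "\<lambda>t. ennreal (t powr (-1/2)) * indicator {0..\<sigma>} t"
  have half: "(\<integral>\<^sup>+t. ?f t \<partial>lborel) = ennreal (2 * sqrt \<sigma>)"
  proof (rule nn_integral_has_integral_lebesgue')
    show "((\<lambda>t. t powr (-1/2)) has_integral 2 * sqrt \<sigma>) {0..\<sigma>}"
      using has_integral_powr_from_0[of "-1/2" \<sigma>] assms by (simp add: powr_half_sqrt mult.commute)
  qed simp
  have reflect: "(\<integral>\<^sup>+t. ?f t \<partial>lborel) = (\<integral>\<^sup>+t. ?f (- t) \<partial>lborel)"
    by (subst nn_integral_real_affine[where c = "-1" and t = 0]) auto
  have ne: "AE t in lborel. t \<noteq> (0 :: real)"
    by (rule AE_lborel_singleton)
  have "(\<integral>\<^sup>+t. rsqrt t * indicator {-\<sigma>..\<sigma>} t \<partial>lborel) \<le> (\<integral>\<^sup>+t. ?f t + ?f (- t) \<partial>lborel)"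
  proof (intro nn_integral_mono_AE eventually_mono[OF ne])
    fix t :: real assume "t \<noteq> 0"
    then have "rsqrt t = ennreal (\<bar>t\<bar> powr (-1/2))"
      by (simp add: rsqrt_def inverse_ennreal powr_minus powr_half_sqrt)
    with \<open>t \<noteq> 0\<close> show "rsqrt t * indicator {-\<sigma>..\<sigma>} t \<le> ?f t + ?f (- t)"
      by (cases "t > 0") (auto split: split_indicator)
  qed
  also have "\<dots> = (\<integral>\<^sup>+t. ?f t \<partial>lborel) + (\<integral>\<^sup>+t. ?f (- t) \<partial>lborel)"
    by (rule nn_integral_add) measurable
  also have "\<dots> = ennreal (4 * sqrt \<sigma>)"
    unfolding reflect[symmetric] half using assms by (simp flip: ennreal_plus)
  finally show ?thesis .
qed

lemma nn_integral_normal_density: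
  assumes "\<sigma> > 0"
  shows "(\<integral>\<^sup>+t. ennreal (normal_density y \<sigma> t) \<partial>lborel) = 1"
  using assms by (subst nn_integral_eq_integral) auto

text \<open>
  Within distance \<open>\<sigma>\<close> of \<open>a\<close> the density is at most \<open>1 / \<sigma>\<close> and the singularity contributes
  \<open>4 \<sigma>\<^sup>1\<^sup>/\<^sup>2\<close>; farther away the singular factor is at most \<open>\<sigma>\<^sup>-\<^sup>1\<^sup>/\<^sup>2\<close> and the density has mass \<open>1\<close>.
\<close>

lemma nn_integral_normal_density_rsqrt:
  assumes \<sigma>: "\<sigma> > 0"
  shows "(\<integral>\<^sup>+t. ennreal (normal_density y \<sigma> t) * rsqrt (t - a) \<partial>lborel) \<le> ennreal (5 / sqrt \<sigma>)"
proof -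
  have dens: "normal_density y \<sigma> t \<le> 1 / \<sigma>" for t
  proof -
    have "1 * \<sigma> \<le> sqrt (2 * pi) * \<sigma>"
      using \<sigma> pi_ge_two by (intro mult_right_mono) auto
    then have "1 / (sqrt (2 * pi) * \<sigma>) * exp (- (t - y)\<^sup>2 / (2 * \<sigma>\<^sup>2)) \<le> 1 / \<sigma> * 1"
      using \<sigma> by (intro mult_mono) (auto intro!: divide_left_mono)
    then show ?thesis
      using \<sigma> by (simp add: normal_density_def real_sqrt_mult)
  qed
  have "(\<integral>\<^sup>+t. ennreal (normal_density y \<sigma> t) * rsqrt (t - a) \<partial>lborel)
      \<le> (\<integral>\<^sup>+t. ennreal (1 / \<sigma>) * (rsqrt (t - a) * indicator {-\<sigma>..\<sigma>} (t - a))
            + ennreal (1 / sqrt \<sigma>) * ennreal (normal_density y \<sigma> t) \<partial>lborel)"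
  proof (rule nn_integral_mono)
    fix t
    show "ennreal (normal_density y \<sigma> t) * rsqrt (t - a)
      \<le> ennreal (1 / \<sigma>) * (rsqrt (t - a) * indicator {-\<sigma>..\<sigma>} (t - a))
            + ennreal (1 / sqrt \<sigma>) * ennreal (normal_density y \<sigma> t)"
    proof (cases "t - a \<in> {-\<sigma>..\<sigma>}")
      case True
      then show ?thesis
        using dens[of t] by (simp add: add_increasing2 mult_right_mono)
    next
      case False
      then have le: "sqrt \<sigma> \<le> sqrt \<bar>t - a\<bar>" by auto
      have pos: "sqrt \<sigma> > 0" using \<sigma> by simp
      have "1 / sqrt \<bar>t - a\<bar> \<le> 1 / sqrt \<sigma>"
        using le pos by (intro divide_left_mono) auto
      then have "rsqrt (t - a) \<le> ennreal (1 / sqrt \<sigma>)"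
        unfolding rsqrt_def using le pos by (subst inverse_ennreal) (auto simp: inverse_eq_divide)
      then have "ennreal (normal_density y \<sigma> t) * rsqrt (t - a)
          \<le> ennreal (normal_density y \<sigma> t) * ennreal (1 / sqrt \<sigma>)"
        by (rule mult_left_mono) simp
      then show ?thesis using False by (simp add: mult.commute)
    qed
  qed
  also have "\<dots> = ennreal (1 / \<sigma>) * (\<integral>\<^sup>+t. rsqrt (t - a) * indicator {-\<sigma>..\<sigma>} (t - a) \<partial>lborel) + ennreal (1 / sqrt \<sigma>)"
    using \<sigma> by (subst nn_integral_add) (auto simp: nn_integral_cmult nn_integral_normal_density)
  also have "(\<integral>\<^sup>+t. rsqrt (t - a) * indicator {-\<sigma>..\<sigma>} (t - a) \<partial>lborel) = (\<integral>\<^sup>+t. rsqrt t * indicator {-\<sigma>..\<sigma>} t \<partial>lborel)"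
    by (subst (2) nn_integral_real_affine[where c = 1 and t = "- a"]) auto
  also have "ennreal (1 / \<sigma>) * \<dots> + ennreal (1 / sqrt \<sigma>) \<le> ennreal (1 / \<sigma>) * ennreal (4 * sqrt \<sigma>) + ennreal (1 / sqrt \<sigma>)"
    using \<sigma> by (intro add_right_mono mult_left_mono nn_integral_rsqrt_le) auto
  also have "\<dots> = ennreal (1 / \<sigma> * (4 * sqrt \<sigma>) + 1 / sqrt \<sigma>)"
    using \<sigma> by (simp flip: ennreal_mult ennreal_plus)
  also have "1 / \<sigma> * (4 * sqrt \<sigma>) + 1 / sqrt \<sigma> = 5 / sqrt \<sigma>"
    using \<sigma> real_sqrt_mult_self[of \<sigma>] by (simp add: field_simps)
  finally show ?thesis .
qed

text \<open>
  A factor \<open>w\<close> whose one-dimensional averages in the coordinate \<open>i\<close> are at most \<open>M\<close> can be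
  replaced by \<open>M\<close>, as long as the remaining factor \<open>h\<close> does not depend on that coordinate.
\<close>

lemma nn_integral_gauss_coordinate_le:
  fixes w h :: "real ^ 'n \<Rightarrow> ennreal"
  assumes \<sigma>: "\<sigma> > 0"
    and [measurable]: "w \<in> borel_measurable borel" "h \<in> borel_measurable borel"
    and h: "\<And>x t. h (vec_upd x i t) = h x"
    and w: "\<And>x. (\<integral>\<^sup>+t. ennreal (normal_density (y $ i) \<sigma> t) * w (vec_upd x i t) \<partial>lborel) \<le> M"
  shows "(\<integral>\<^sup>+x. ennreal (gauss_kernel \<sigma> (y - x)) * (w x * h x) \<partial>lborel)
    \<le> M * (\<integral>\<^sup>+x. ennreal (gauss_kernel \<sigma> (y - x)) * h x \<partial>lborel)"
proof -
  define P where "P x = (\<Prod>k\<in>UNIV - {i}. normal_density 0 \<sigma> (y $ k - x $ k))" for x :: "real ^ 'n"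
  have P: "P x \<ge> 0" for x unfolding P_def by (intro prod_nonneg) simp
  have K: "ennreal (gauss_kernel \<sigma> (y - vec_upd x i t)) = ennreal (normal_density (y $ i) \<sigma> t) * ennreal (P x)" for x t
  proof -
    have "gauss_kernel \<sigma> (y - vec_upd x i t) = normal_density 0 \<sigma> (y $ i - t) * P x"
      unfolding gauss_kernel_def P_def by (subst prod.remove[of _ i]) (auto intro!: prod.cong)
    also have "normal_density 0 \<sigma> (y $ i - t) = normal_density (y $ i) \<sigma> t"
      by (simp add: normal_density_def power2_commute)
    finally show ?thesis using P by (simp add: ennreal_mult)
  qed
  have "(\<integral>\<^sup>+x. ennreal (gauss_kernel \<sigma> (y - x)) * (w x * h x) \<partial>lborel)
      \<le> (\<integral>\<^sup>+x. M * (ennreal (gauss_kernel \<sigma> (y - x)) * h x) \<partial>lborel)"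
  proof (rule nn_integral_coordinate_mono[where i = i])
    fix x
    have "(\<integral>\<^sup>+t. ennreal (gauss_kernel \<sigma> (y - vec_upd x i t)) * (w (vec_upd x i t) * h (vec_upd x i t)) \<partial>lborel)
        = (\<integral>\<^sup>+t. (ennreal (P x) * h x) * (ennreal (normal_density (y $ i) \<sigma> t) * w (vec_upd x i t)) \<partial>lborel)"
      unfolding K h by (simp add: mult_ac)
    also have "\<dots> = (ennreal (P x) * h x) * (\<integral>\<^sup>+t. ennreal (normal_density (y $ i) \<sigma> t) * w (vec_upd x i t) \<partial>lborel)"
      by (rule nn_integral_cmult) measurable
    also have "\<dots> \<le> (ennreal (P x) * h x) * (M * (\<integral>\<^sup>+t. ennreal (normal_density (y $ i) \<sigma> t) \<partial>lborel))"
      using w[of x] by (simp add: nn_integral_normal_density[OF \<sigma>] mult_left_mono)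
    also have "\<dots> = (\<integral>\<^sup>+t. (M * (ennreal (P x) * h x)) * ennreal (normal_density (y $ i) \<sigma> t) \<partial>lborel)"
      by (subst nn_integral_cmult) (auto simp: mult_ac)
    also have "\<dots> = (\<integral>\<^sup>+t. M * (ennreal (gauss_kernel \<sigma> (y - vec_upd x i t)) * h (vec_upd x i t)) \<partial>lborel)"
      unfolding K h by (simp add: mult_ac)
    finally show "(\<integral>\<^sup>+t. ennreal (gauss_kernel \<sigma> (y - vec_upd x i t)) * (w (vec_upd x i t) * h (vec_upd x i t)) \<partial>lborel)
       \<le> (\<integral>\<^sup>+t. M * (ennreal (gauss_kernel \<sigma> (y - vec_upd x i t)) * h (vec_upd x i t)) \<partial>lborel)" .
  qed measurable
  then show ?thesis by (simp add: nn_integral_cmult)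
qed

section \<open>The reciprocal of the symbol\<close>

lemma norm_q_symbol_bounds:
  shows "\<bar>\<tau>\<^sup>2 - (norm \<xi>)\<^sup>2\<bar> \<le> norm (q_symbol e \<tau> \<xi>)"
    and "2 * \<bar>\<tau> * \<xi> $ e\<bar> \<le> norm (q_symbol e \<tau> \<xi>)"
  using abs_Re_le_cmod[of "q_symbol e \<tau> \<xi>"] abs_Im_le_cmod[of "q_symbol e \<tau> \<xi>"]
  by (simp_all add: q_symbol_def abs_mult power2_eq_square)

text \<open>
  When all coordinates but the \<open>j\<close>-th are fixed, the sphere of radius \<open>\<bar>\<tau>\<bar>\<close> is met at the \<open>j\<close>-th coordinates
  \<open>\<plusminus> sphere_coord \<tau> j x\<close>; the value is \<open>0\<close> when the line misses the sphere.
\<close>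

definition sphere_coord :: "real \<Rightarrow> 'n \<Rightarrow> real ^ 'n \<Rightarrow> real" where
  "sphere_coord \<tau> j x = sqrt (max 0 (\<tau>\<^sup>2 - (\<Sum>k\<in>UNIV - {j}. (x $ k)\<^sup>2)))"

lemma sphere_coord_vec_upd [simp]: "sphere_coord \<tau> j (vec_upd x j t) = sphere_coord \<tau> j x"
  unfolding sphere_coord_def by simp

lemma sphere_coord_measurable [measurable]:
  "sphere_coord \<tau> j \<in> borel_measurable borel"
  unfolding sphere_coord_def by measurable

lemma norm_power2_vec: "(norm (x :: real ^ 'n))\<^sup>2 = (\<Sum>k\<in>UNIV. (x $ k)\<^sup>2)"
  by (simp add: norm_vec_def L2_set_def sum_nonneg)

text \<open>
  Along the \<open>j\<close>-th axis \<open>\<tau>\<^sup>2 - \<bar>\<xi>\<bar>\<^sup>2 = s - \<xi>\<^sub>j\<^sup>2\<close> with \<open>s\<close> fixed.  For \<open>s \<ge> 0\<close> this factors as a difference of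
  squares, and \<open>b\<close> is the root on the same side as \<open>\<xi>\<^sub>j\<close>, which makes the other factor at least \<open>\<bar>\<xi>\<^sub>j\<bar>\<close>.
  For \<open>s < 0\<close> the value \<open>b = 0\<close> will do.
\<close>

lemma distance_to_sphere_along_axis:
  fixes \<xi> :: "real ^ 'n" and j :: 'n and \<tau> :: real
  defines "a \<equiv> sphere_coord \<tau> j \<xi>"
  shows "\<exists>b\<in>{a, - a, 0}. \<bar>\<xi> $ j\<bar> * \<bar>\<xi> $ j - b\<bar> \<le> \<bar>\<tau>\<^sup>2 - (norm \<xi>)\<^sup>2\<bar>"
proof -
  define s where "s = \<tau>\<^sup>2 - (\<Sum>k\<in>UNIV - {j}. (\<xi> $ k)\<^sup>2)"
  have m: "\<tau>\<^sup>2 - (norm \<xi>)\<^sup>2 = s - (\<xi> $ j)\<^sup>2"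
    unfolding norm_power2_vec s_def by (subst sum.remove[of _ j]) auto
  show ?thesis
  proof (cases "s \<ge> 0")
    case True
    then have a: "a \<ge> 0" "a\<^sup>2 = s" by (simp_all add: a_def sphere_coord_def s_def[symmetric])
    define b where "b = (if \<xi> $ j \<ge> 0 then a else - a)"
    have "\<bar>s - (\<xi> $ j)\<^sup>2\<bar> = \<bar>\<xi> $ j + b\<bar> * \<bar>\<xi> $ j - b\<bar>"
      using a(2) by (auto simp: b_def power2_eq_square algebra_simps abs_minus_commute simp flip: abs_mult)
    moreover have "\<bar>\<xi> $ j\<bar> \<le> \<bar>\<xi> $ j + b\<bar>" using a(1) by (auto simp: b_def)
    ultimately have "\<bar>\<xi> $ j\<bar> * \<bar>\<xi> $ j - b\<bar> \<le> \<bar>s - (\<xi> $ j)\<^sup>2\<bar>" by (simp add: mult_right_mono)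
    moreover have "b \<in> {a, - a, 0}" by (simp add: b_def)
    ultimately show ?thesis unfolding m by blast
  next
    case False
    then have "\<bar>\<xi> $ j\<bar> * \<bar>\<xi> $ j - 0\<bar> \<le> \<bar>s - (\<xi> $ j)\<^sup>2\<bar>"
      by (simp add: power2_eq_square)
    then show ?thesis unfolding m by blast
  qed
qed

text \<open>
  If some coordinate other than \<open>\<xi>\<^sub>e\<close> has size comparable to \<open>\<tau>\<close>, then the previous lemma bounds, up to a constant,
  \<open>\<tau> \<bar>\<xi>\<^sub>j - b\<bar>\<close> by \<open>\<bar>q\<bar>\<close>, and \<open>\<tau> \<bar>\<xi>\<^sub>e\<bar>\<close> is bounded by \<open>\<bar>q\<bar>\<close> anyway.  If all these coordinates are small, then
  \<open>\<xi>\<close> is far from the zero set of the symbol: either \<open>\<bar>\<xi>\<^sub>e\<bar>\<close> is at least \<open>\<tau> / 2\<close>, or \<open>\<bar>\<xi>\<bar>\<^sup>2 \<le> \<tau>\<^sup>2 / 2\<close>.  In that case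
  \<open>b = 0\<close> works for any \<open>j\<close>, because \<open>\<bar>\<xi>\<^sub>j\<bar> \<le> \<tau>\<close>.
\<close>

lemma q_symbol_product_lower_bound:
  fixes \<xi> :: "real ^ 'n" and e :: 'n
  assumes \<tau>: "\<tau> > 0" and j0: "j0 \<noteq> e"
  shows "\<exists>j b. j \<noteq> e \<and> b \<in> {sphere_coord \<tau> j \<xi>, - sphere_coord \<tau> j \<xi>, 0} \<and>
    \<tau>\<^sup>2 * (\<bar>\<xi> $ e\<bar> * \<bar>\<xi> $ j - b\<bar>) \<le> CARD('n) * (norm (q_symbol e \<tau> \<xi>))\<^sup>2"
proof -
  define N where "N = real CARD('n)"
  have N: "N \<ge> 1" unfolding N_def by (simp add: Suc_leI)
  define q where "q = norm (q_symbol e \<tau> \<xi>)"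
  define m where "m = \<bar>\<tau>\<^sup>2 - (norm \<xi>)\<^sup>2\<bar>"
  have q1: "m \<le> q" and q2: "2 * (\<tau> * \<bar>\<xi> $ e\<bar>) \<le> q"
    using norm_q_symbol_bounds[of \<tau> \<xi> e] \<tau> by (simp_all add: q_def m_def abs_mult)
  have m0: "m \<ge> 0" by (simp add: m_def)
  have qq: "m * (2 * (\<tau> * \<bar>\<xi> $ e\<bar>)) \<le> q\<^sup>2"
    unfolding power2_eq_square using q1 q2 m0 \<tau> by (intro mult_mono) auto
  show ?thesis
  \<comment> \<open>The threshold ensures that the squares of the small coordinates add up to at most \<open>\<tau>\<^sup>2 / 4\<close>.\<close>
  proof (cases "\<exists>j. j \<noteq> e \<and> (\<tau> / (2 * sqrt N)) \<le> \<bar>\<xi> $ j\<bar>")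
    case True
    then obtain j where j: "j \<noteq> e" "\<tau> / (2 * sqrt N) \<le> \<bar>\<xi> $ j\<bar>" by blast
    obtain b where b: "b \<in> {sphere_coord \<tau> j \<xi>, - sphere_coord \<tau> j \<xi>, 0}"
      "\<bar>\<xi> $ j\<bar> * \<bar>\<xi> $ j - b\<bar> \<le> m"
      using distance_to_sphere_along_axis[of \<tau> j \<xi>] unfolding m_def by blast
    have "sqrt N \<ge> 1" using N by simp
    have "\<tau> / (2 * sqrt N) * \<bar>\<xi> $ j - b\<bar> \<le> m"
      using j(2) b(2) mult_right_mono[OF j(2), of "\<bar>\<xi> $ j - b\<bar>"] by linarith
    then have "\<tau> / (2 * sqrt N) * \<bar>\<xi> $ j - b\<bar> * (2 * (\<tau> * \<bar>\<xi> $ e\<bar>)) \<le> q\<^sup>2"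
      using qq \<tau> by (meson mult_right_mono order_trans zero_le_mult_iff abs_ge_zero less_imp_le zero_le_numeral)
    then have "\<tau>\<^sup>2 * (\<bar>\<xi> $ e\<bar> * \<bar>\<xi> $ j - b\<bar>) \<le> sqrt N * q\<^sup>2"
      using \<open>sqrt N \<ge> 1\<close> by (simp add: field_simps power2_eq_square)
    also have "\<dots> \<le> N * q\<^sup>2"
      using N by (intro mult_right_mono) (auto intro: sqrt_le_D simp: real_le_lsqrt power2_eq_square)
    finally show ?thesis using j(1) b(1) unfolding N_def q_def by blast
  next
    case False
    then have small: "\<bar>\<xi> $ j\<bar> < \<tau> / (2 * sqrt N)" if "j \<noteq> e" for j using that by force
    have "1 \<le> 2 * sqrt N" using real_sqrt_ge_one[OF N] by linarith
    then have "\<tau> / (2 * sqrt N) \<le> \<tau>"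
      using \<tau> N mult_left_mono[of 1 "2 * sqrt N" \<tau>] by (simp add: divide_le_eq)
    then have j0\<tau>: "\<bar>\<xi> $ j0\<bar> \<le> \<tau>" using small[OF j0] by linarith
    have "\<tau>\<^sup>2 * (\<bar>\<xi> $ e\<bar> * \<bar>\<xi> $ j0 - 0\<bar>) \<le> \<tau>\<^sup>2 * (\<bar>\<xi> $ e\<bar> * \<tau>)"
      using j0\<tau> by (intro mult_left_mono) auto
    also have "\<dots> \<le> q\<^sup>2"
    proof (cases "\<bar>\<xi> $ e\<bar> \<ge> \<tau> / 2")
      case True
      have "\<tau>\<^sup>2 * (\<bar>\<xi> $ e\<bar> * \<tau>) \<le> \<tau>\<^sup>2 * (\<bar>\<xi> $ e\<bar> * (4 * \<bar>\<xi> $ e\<bar>))"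
        using True \<tau> by (intro mult_left_mono) auto
      also have "\<dots> = (2 * (\<tau> * \<bar>\<xi> $ e\<bar>))\<^sup>2" by (simp add: power2_eq_square)
      also have "\<dots> \<le> q\<^sup>2" using q2 \<tau> by (intro power_mono) auto
      finally show ?thesis .
    next
      case False
      have "(\<Sum>k\<in>UNIV - {e}. (\<xi> $ k)\<^sup>2) \<le> (\<Sum>k\<in>UNIV - {e}. \<tau>\<^sup>2 / (4 * N))"
      proof (rule sum_mono)
        fix k assume "k \<in> UNIV - {e}"
        then have "\<bar>\<xi> $ k\<bar>\<^sup>2 \<le> (\<tau> / (2 * sqrt N))\<^sup>2"
          using small[of k] by (intro power_mono) auto
        then show "(\<xi> $ k)\<^sup>2 \<le> \<tau>\<^sup>2 / (4 * N)" using N by (simp add: power_divide power_mult_distrib)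
      qed
      also have "\<dots> \<le> (\<Sum>k\<in>(UNIV :: 'n set). \<tau>\<^sup>2 / (4 * N))"
        using N by (intro sum_mono2) auto
      also have "\<dots> = \<tau>\<^sup>2 / 4" by (simp add: N_def)
      finally have "(\<Sum>k\<in>UNIV - {e}. (\<xi> $ k)\<^sup>2) \<le> \<tau>\<^sup>2 / 4" .
      moreover have "\<bar>\<xi> $ e\<bar>\<^sup>2 \<le> (\<tau> / 2)\<^sup>2" using False by (intro power_mono) auto
      ultimately have "(norm \<xi>)\<^sup>2 \<le> \<tau>\<^sup>2 / 2"
        unfolding norm_power2_vec by (subst sum.remove[of _ e]) (auto simp: power_divide)
      then have "\<tau>\<^sup>2 / 2 \<le> m" unfolding m_def by linarith
      then have "\<tau>\<^sup>2 / 2 * (2 * (\<tau> * \<bar>\<xi> $ e\<bar>)) \<le> q\<^sup>2"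
        using qq \<tau> by (meson mult_right_mono order_trans zero_le_mult_iff abs_ge_zero less_imp_le zero_le_numeral)
      then show ?thesis by (simp add: mult_ac)
    qed
    also have "q\<^sup>2 \<le> N * q\<^sup>2" using N by (simp add: mult_right_mono[of 1 N "q\<^sup>2", simplified])
    finally show ?thesis using j0 unfolding N_def q_def by blast
  qed
qed

text \<open>
  One term for each candidate \<open>b\<close> in \<open>q_symbol_product_lower_bound\<close>.
\<close>

definition axis_weight :: "real \<Rightarrow> 'n \<Rightarrow> real ^ 'n \<Rightarrow> ennreal" where
  "axis_weight \<tau> j \<xi> = rsqrt (\<xi> $ j - sphere_coord \<tau> j \<xi>) + rsqrt (\<xi> $ j + sphere_coord \<tau> j \<xi>) + rsqrt (\<xi> $ j)"

lemma axis_weight_measurable [measurable]: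
  "axis_weight \<tau> j \<in> borel_measurable (borel :: (real ^ 'n) measure)"
  unfolding axis_weight_def by measurable

lemma q_symbol_measurable [measurable]: "q_symbol e \<tau> \<in> borel_measurable (borel :: (real ^ 'n) measure)"
  unfolding q_symbol_def by measurable

text \<open>
  Square roots and reciprocals of the preceding bound; the sum absorbs the dependence of
  \<open>j\<close> and \<open>b\<close> on \<open>\<xi>\<close>.
\<close>

lemma inverse_q_symbol_le:
  fixes \<xi> :: "real ^ 'n" and e :: 'n
  assumes \<tau>: "\<tau> > 0" and j0: "j0 \<noteq> e"
  shows "inverse (ennreal (norm (q_symbol e \<tau> \<xi>)))
    \<le> ennreal (sqrt CARD('n) / \<tau>) * (\<Sum>j\<in>UNIV - {e}. axis_weight \<tau> j \<xi> * rsqrt (\<xi> $ e))"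
proof -
  define N where "N = real CARD('n)"
  have N: "N > 0" unfolding N_def by simp
  define q where "q = norm (q_symbol e \<tau> \<xi>)"
  obtain j b where j: "j \<noteq> e" and b: "b \<in> {sphere_coord \<tau> j \<xi>, - sphere_coord \<tau> j \<xi>, 0}"
    and le: "\<tau>\<^sup>2 * (\<bar>\<xi> $ e\<bar> * \<bar>\<xi> $ j - b\<bar>) \<le> N * q\<^sup>2"
    using q_symbol_product_lower_bound[OF \<tau> j0, of \<xi>] unfolding N_def q_def by blast
  define X where "X = sqrt \<bar>\<xi> $ e\<bar> * sqrt \<bar>\<xi> $ j - b\<bar>"
  have "\<tau> * X \<le> sqrt N * q"
    using real_sqrt_le_mono[OF le] \<tau> by (simp add: real_sqrt_mult X_def q_def)
  then have "\<tau> / sqrt N * X \<le> q" using N by (simp add: field_simps)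
  then have "inverse (ennreal q) \<le> inverse (ennreal (\<tau> / sqrt N * X))"
    by (intro inverse_ennreal_antimono ennreal_leI)
  also have "\<dots> = inverse (ennreal (\<tau> / sqrt N) * (ennreal (sqrt \<bar>\<xi> $ j - b\<bar>) * ennreal (sqrt \<bar>\<xi> $ e\<bar>)))"
    unfolding X_def using \<tau> N by (subst ennreal_mult, simp, simp, subst ennreal_mult) (simp_all add: mult_ac)
  also have "\<dots> = inverse (ennreal (\<tau> / sqrt N)) * (rsqrt (\<xi> $ j - b) * rsqrt (\<xi> $ e))"
    unfolding rsqrt_def by (simp add: ennreal_inverse_mult ennreal_mult_less_top)
  also have "inverse (ennreal (\<tau> / sqrt N)) = ennreal (sqrt N / \<tau>)"
    using \<tau> N by (simp add: inverse_ennreal)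
  also have "\<dots> * (rsqrt (\<xi> $ j - b) * rsqrt (\<xi> $ e))
      \<le> ennreal (sqrt N / \<tau>) * (\<Sum>j\<in>UNIV - {e}. axis_weight \<tau> j \<xi> * rsqrt (\<xi> $ e))"
  proof (intro mult_left_mono)
    have "rsqrt (\<xi> $ j - b) \<le> axis_weight \<tau> j \<xi>"
      using b by (auto simp: axis_weight_def add_increasing add_increasing2)
    then have "rsqrt (\<xi> $ j - b) * rsqrt (\<xi> $ e) \<le> axis_weight \<tau> j \<xi> * rsqrt (\<xi> $ e)"
      by (rule mult_right_mono) simp
    also have "\<dots> \<le> (\<Sum>j\<in>UNIV - {e}. axis_weight \<tau> j \<xi> * rsqrt (\<xi> $ e))"
      using j by (intro member_le_sum) auto
    finally show "rsqrt (\<xi> $ j - b) * rsqrt (\<xi> $ e) \<le> (\<Sum>j\<in>UNIV - {e}. axis_weight \<tau> j \<xi> * rsqrt (\<xi> $ e))" .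
  qed simp
  finally show ?thesis unfolding q_def N_def .
qed

text \<open>
  In each term of \<open>inverse_q_symbol_le\<close> the coordinate \<open>\<xi>\<^sub>j\<close> is averaged before \<open>\<xi>\<^sub>e\<close>, because the point
  \<open>sphere_coord \<tau> j \<xi>\<close> depends on \<open>\<xi>\<^sub>e\<close> but not on \<open>\<xi>\<^sub>j\<close>.  The constant is \<open>15 \<cdot> 5\<close> per term: three singular
  points in the \<open>j\<close>-th coordinate and one in the coordinate \<open>e\<close>.
\<close>

lemma gauss_average_inverse_q_symbol:
  fixes y :: "real ^ 'n" and e :: 'n
  assumes \<tau>: "\<tau> > 0" and \<sigma>: "\<sigma> > 0" and j0: "j0 \<noteq> e"
  shows "(\<integral>\<^sup>+\<xi>. ennreal (gauss_kernel \<sigma> (y - \<xi>)) * inverse (ennreal (norm (q_symbol e \<tau> \<xi>))) \<partial>lborel)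
    \<le> ennreal (75 * real CARD('n) * sqrt CARD('n) / (\<tau> * \<sigma>))"
proof -
  have K1: "(\<integral>\<^sup>+\<xi>. ennreal (gauss_kernel \<sigma> (y - \<xi>)) \<partial>lborel) = 1"
    using nn_integral_gauss_kernel[OF \<sigma>, of y] by (simp add: gauss_kernel_minus_commute[of \<sigma> y])
  have e: "(\<integral>\<^sup>+\<xi>. ennreal (gauss_kernel \<sigma> (y - \<xi>)) * rsqrt (\<xi> $ e) \<partial>lborel) \<le> ennreal (5 / sqrt \<sigma>)"
  proof -
    have "(\<integral>\<^sup>+\<xi>. ennreal (gauss_kernel \<sigma> (y - \<xi>)) * (rsqrt (\<xi> $ e) * 1) \<partial>lborel)
        \<le> ennreal (5 / sqrt \<sigma>) * (\<integral>\<^sup>+\<xi>. ennreal (gauss_kernel \<sigma> (y - \<xi>)) * 1 \<partial>lborel)"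
      using nn_integral_normal_density_rsqrt[OF \<sigma>, of "y $ e" 0]
      by (intro nn_integral_gauss_coordinate_le[OF \<sigma>, where i = e]) auto
    then show ?thesis by (simp add: K1)
  qed
  have j: "(\<integral>\<^sup>+\<xi>. ennreal (gauss_kernel \<sigma> (y - \<xi>)) * (axis_weight \<tau> j \<xi> * rsqrt (\<xi> $ e)) \<partial>lborel)
      \<le> ennreal (75 / \<sigma>)" if "j \<noteq> e" for j
  proof -
    have "(\<integral>\<^sup>+\<xi>. ennreal (gauss_kernel \<sigma> (y - \<xi>)) * (axis_weight \<tau> j \<xi> * rsqrt (\<xi> $ e)) \<partial>lborel)
        \<le> ennreal (15 / sqrt \<sigma>) * (\<integral>\<^sup>+\<xi>. ennreal (gauss_kernel \<sigma> (y - \<xi>)) * rsqrt (\<xi> $ e) \<partial>lborel)"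
    proof (rule nn_integral_gauss_coordinate_le[OF \<sigma>, where i = j])
      fix x :: "real ^ 'n"
      let ?a = "sphere_coord \<tau> j x" and ?N = "\<lambda>t. ennreal (normal_density (y $ j) \<sigma> t)"
      have "(\<integral>\<^sup>+t. ?N t * axis_weight \<tau> j (vec_upd x j t) \<partial>lborel)
          = (\<integral>\<^sup>+t. ?N t * rsqrt (t - ?a) \<partial>lborel) + (\<integral>\<^sup>+t. ?N t * rsqrt (t - (- ?a)) \<partial>lborel)
             + (\<integral>\<^sup>+t. ?N t * rsqrt (t - 0) \<partial>lborel)"
        by (simp add: axis_weight_def distrib_left nn_integral_add)
      also have "\<dots> \<le> ennreal (5 / sqrt \<sigma>) + ennreal (5 / sqrt \<sigma>) + ennreal (5 / sqrt \<sigma>)"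
        by (intro add_mono nn_integral_normal_density_rsqrt \<sigma>)
      also have "\<dots> = ennreal (15 / sqrt \<sigma>)" using \<sigma> by (simp flip: ennreal_plus)
      finally show "(\<integral>\<^sup>+t. ?N t * axis_weight \<tau> j (vec_upd x j t) \<partial>lborel) \<le> ennreal (15 / sqrt \<sigma>)" .
    qed (use that in auto)
    also have "\<dots> \<le> ennreal (15 / sqrt \<sigma>) * ennreal (5 / sqrt \<sigma>)"
      by (intro mult_left_mono e) simp
    also have "\<dots> = ennreal (75 / \<sigma>)"
      using \<sigma> by (simp flip: ennreal_mult)
    finally show ?thesis .
  qed
  have "(\<integral>\<^sup>+\<xi>. ennreal (gauss_kernel \<sigma> (y - \<xi>)) * inverse (ennreal (norm (q_symbol e \<tau> \<xi>))) \<partial>lborel)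
      \<le> (\<integral>\<^sup>+\<xi>. ennreal (sqrt CARD('n) / \<tau>) *
          (\<Sum>j\<in>UNIV - {e}. ennreal (gauss_kernel \<sigma> (y - \<xi>)) * (axis_weight \<tau> j \<xi> * rsqrt (\<xi> $ e))) \<partial>lborel)"
  proof (rule nn_integral_mono)
    fix \<xi> :: "real ^ 'n"
    have "ennreal (gauss_kernel \<sigma> (y - \<xi>)) * inverse (ennreal (norm (q_symbol e \<tau> \<xi>)))
        \<le> ennreal (gauss_kernel \<sigma> (y - \<xi>)) *
          (ennreal (sqrt CARD('n) / \<tau>) * (\<Sum>j\<in>UNIV - {e}. axis_weight \<tau> j \<xi> * rsqrt (\<xi> $ e)))"
      by (intro mult_left_mono inverse_q_symbol_le[OF \<tau> j0]) simp
    then show "ennreal (gauss_kernel \<sigma> (y - \<xi>)) * inverse (ennreal (norm (q_symbol e \<tau> \<xi>)))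
        \<le> ennreal (sqrt CARD('n) / \<tau>) *
          (\<Sum>j\<in>UNIV - {e}. ennreal (gauss_kernel \<sigma> (y - \<xi>)) * (axis_weight \<tau> j \<xi> * rsqrt (\<xi> $ e)))"
      by (simp only: sum_distrib_left mult_ac)
  qed
  also have "\<dots> = ennreal (sqrt CARD('n) / \<tau>) *
      (\<Sum>j\<in>UNIV - {e}. \<integral>\<^sup>+\<xi>. ennreal (gauss_kernel \<sigma> (y - \<xi>)) * (axis_weight \<tau> j \<xi> * rsqrt (\<xi> $ e)) \<partial>lborel)"
    by (subst nn_integral_cmult, measurable, subst nn_integral_sum) auto
  also have "\<dots> \<le> ennreal (sqrt CARD('n) / \<tau>) * (\<Sum>j\<in>UNIV - {e}. ennreal (75 / \<sigma>))"
    by (intro mult_left_mono sum_mono j) auto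
  also have "\<dots> \<le> ennreal (sqrt CARD('n) / \<tau>) * (\<Sum>j\<in>(UNIV :: 'n set). ennreal (75 / \<sigma>))"
    by (intro mult_left_mono sum_mono2) auto
  also have "\<dots> = ennreal (75 * real CARD('n) * sqrt CARD('n) / (\<tau> * \<sigma>))"
    using \<tau> \<sigma> by (simp add: ennreal_of_nat_eq_real_of_nat mult_ac flip: ennreal_mult)
  finally show ?thesis .
qed

text \<open>
  The arithmetic-geometric inequality gives
  \<open>f(x) f(y) \<le> w(x) f(x)\<^sup>2 / w(y) + w(y) f(y)\<^sup>2 / w(x)\<close>, and the two terms have equal integrals because the kernel is
  symmetric.  The weight may vanish only on a null set, as the averages of its reciprocal are finite.
\<close>

lemma weighted_schur_bound:
  fixes w f :: "real ^ 'n \<Rightarrow> real"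
  assumes \<sigma>: "\<sigma> > 0"
    and [measurable]: "w \<in> borel_measurable borel" "f \<in> borel_measurable borel"
    and w: "\<And>x. w x \<ge> 0" and f: "\<And>x. f x \<ge> 0"
    and M: "\<And>y. (\<integral>\<^sup>+x. ennreal (gauss_kernel \<sigma> (y - x)) * inverse (ennreal (w x)) \<partial>lborel) \<le> ennreal M"
  shows "(\<integral>\<^sup>+x. \<integral>\<^sup>+y. ennreal (gauss_kernel \<sigma> (x - y) * (f x * f y)) \<partial>lborel \<partial>lborel)
    \<le> 2 * ennreal M * (\<integral>\<^sup>+x. ennreal (w x * (f x)\<^sup>2) \<partial>lborel)"
proof -
  have nz: "AE x in lborel. w x \<noteq> 0"
  proof -
    have "AE x in lborel. ennreal (gauss_kernel \<sigma> (0 - x)) * inverse (ennreal (w x)) \<noteq> \<infinity>"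
      using M[of 0] by (intro nn_integral_noteq_infinite) (auto simp: top_unique)
    then show ?thesis
    proof eventually_elim
      case (elim x)
      have "ennreal (gauss_kernel \<sigma> (0 - x)) \<noteq> 0"
        using gauss_kernel_pos[OF \<sigma>, of "0 - x"] by (simp only: ennreal_eq_0_iff not_le)
      with elim show "w x \<noteq> 0" by (auto simp: ennreal_mult_eq_top_iff)
    qed
  qed
  let ?K = "\<lambda>x y. ennreal (gauss_kernel \<sigma> (x - y))"
  let ?A = "\<lambda>x y. ennreal (w x * (f x)\<^sup>2) * (?K x y * inverse (ennreal (w y)))"
  have A: "(\<integral>\<^sup>+x. \<integral>\<^sup>+y. ?A x y \<partial>lborel \<partial>lborel) \<le> ennreal M * (\<integral>\<^sup>+x. ennreal (w x * (f x)\<^sup>2) \<partial>lborel)"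
  proof -
    have "(\<integral>\<^sup>+x. \<integral>\<^sup>+y. ?A x y \<partial>lborel \<partial>lborel) \<le> (\<integral>\<^sup>+x. ennreal M * ennreal (w x * (f x)\<^sup>2) \<partial>lborel)"
      using mult_left_mono[OF M] by (intro nn_integral_mono) (simp add: nn_integral_cmult mult.commute[of "ennreal M"])
    then show ?thesis by (simp add: nn_integral_cmult)
  qed
  have "(\<integral>\<^sup>+x. \<integral>\<^sup>+y. ?A y x \<partial>lborel \<partial>lborel) = (\<integral>\<^sup>+y. \<integral>\<^sup>+x. ?A y x \<partial>lborel \<partial>lborel)"
    by (rule lborel_pair.Fubini') measurable
  also have "\<dots> \<le> ennreal M * (\<integral>\<^sup>+x. ennreal (w x * (f x)\<^sup>2) \<partial>lborel)" by (rule A)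
  finally have A': "(\<integral>\<^sup>+x. \<integral>\<^sup>+y. ?A y x \<partial>lborel \<partial>lborel) \<le> ennreal M * (\<integral>\<^sup>+x. ennreal (w x * (f x)\<^sup>2) \<partial>lborel)" .
  have "(\<integral>\<^sup>+x. \<integral>\<^sup>+y. ennreal (gauss_kernel \<sigma> (x - y) * (f x * f y)) \<partial>lborel \<partial>lborel)
      \<le> (\<integral>\<^sup>+x. \<integral>\<^sup>+y. ?A x y + ?A y x \<partial>lborel \<partial>lborel)"
  proof (rule nn_integral_mono_AE, use nz in eventually_elim, rule nn_integral_mono_AE, use nz in eventually_elim)
    fix x y assume "w x \<noteq> 0" "w y \<noteq> 0"
    then have wx: "w x > 0" and wy: "w y > 0" using w[of x] w[of y] by auto
    have "0 \<le> (f x * w x - f y * w y)\<^sup>2" by simp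
    then have "2 * (f x * f y) * (w x * w y) \<le> (f x * w x)\<^sup>2 + (f y * w y)\<^sup>2"
      by (simp add: power2_eq_square algebra_simps)
    moreover have "0 \<le> (f x * f y) * (w x * w y)" using wx wy f by simp
    ultimately have "f x * f y * (w x * w y) \<le> (f x * w x)\<^sup>2 + (f y * w y)\<^sup>2" by linarith
    then have "f x * f y \<le> w x * (f x)\<^sup>2 * inverse (w y) + w y * (f y)\<^sup>2 * inverse (w x)"
      using wx wy by (simp add: field_simps power2_eq_square)
    then have "gauss_kernel \<sigma> (x - y) * (f x * f y)
        \<le> gauss_kernel \<sigma> (x - y) * (w x * (f x)\<^sup>2 * inverse (w y) + w y * (f y)\<^sup>2 * inverse (w x))"
      by (intro mult_left_mono) auto
    also have "\<dots> = w x * (f x)\<^sup>2 * (gauss_kernel \<sigma> (x - y) * inverse (w y))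
        + w y * (f y)\<^sup>2 * (gauss_kernel \<sigma> (y - x) * inverse (w x))"
      by (simp add: gauss_kernel_minus_commute[of \<sigma> y x] algebra_simps)
    finally have "ennreal (gauss_kernel \<sigma> (x - y) * (f x * f y))
        \<le> ennreal (w x * (f x)\<^sup>2 * (gauss_kernel \<sigma> (x - y) * inverse (w y))
        + w y * (f y)\<^sup>2 * (gauss_kernel \<sigma> (y - x) * inverse (w x)))"
      by (rule ennreal_leI)
    also have "\<dots> = ?A x y + ?A y x"
      using wx wy by (simp add: inverse_ennreal ennreal_mult ennreal_plus)
    finally show "ennreal (gauss_kernel \<sigma> (x - y) * (f x * f y)) \<le> ?A x y + ?A y x" .
  qed
  also have "\<dots> = (\<integral>\<^sup>+x. \<integral>\<^sup>+y. ?A x y \<partial>lborel \<partial>lborel) + (\<integral>\<^sup>+x. \<integral>\<^sup>+y. ?A y x \<partial>lborel \<partial>lborel)"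
    by (subst nn_integral_add[symmetric], measurable)
       (intro nn_integral_cong, rule nn_integral_add, measurable)
  also have "\<dots> \<le> ennreal M * (\<integral>\<^sup>+x. ennreal (w x * (f x)\<^sup>2) \<partial>lborel)
      + ennreal M * (\<integral>\<^sup>+x. ennreal (w x * (f x)\<^sup>2) \<partial>lborel)"
    by (rule add_mono[OF A A'])
  also have "\<dots> = 2 * ennreal M * (\<integral>\<^sup>+x. ennreal (w x * (f x)\<^sup>2) \<partial>lborel)"
    by (simp add: mult_2 distrib_right)
  finally show ?thesis .
qed

section \<open>Norms of Fourier multipliers\<close>

lemma ennsqrt_power2 [simp]: "(ennsqrt x)\<^sup>2 = x"
  by (cases x) (auto simp: ennsqrt_def ennreal_power)

lemma ennsqrt_mono: "x \<le> y \<Longrightarrow> ennsqrt x \<le> ennsqrt y"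
  by (cases x; cases y) (auto simp: ennsqrt_def top_unique)

lemma ennsqrt_of_power2 [simp]: "ennsqrt (x\<^sup>2) = x"
proof (cases x)
  case top
  then show ?thesis by (simp add: ennsqrt_def power2_eq_square)
qed (simp add: ennsqrt_def ennreal_power)

lemma ennsqrt_cmult:
  assumes "c > 0"
  shows "ennsqrt (ennreal c * x) = ennreal (sqrt c) * ennsqrt x"
  using assms by (cases x) (auto simp: ennsqrt_def ennreal_mult_top real_sqrt_mult simp flip: ennreal_mult)

lemma L2_norm_on_power2:
  "(L2_norm_on A f)\<^sup>2 = (\<integral>\<^sup>+x. ennreal ((norm (f x))\<^sup>2) * indicator A x \<partial>lborel)"
  by (simp add: L2_norm_on_def)

text \<open>
  For integrable \<open>f\<close> this is dominated convergence; otherwise the transform is identically \<open>0\<close>.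
\<close>

lemma continuous_on_fourier: "continuous_on UNIV (fourier f)"
proof (cases "integrable lborel f")
  case True
  have [measurable]: "f \<in> borel_measurable borel"
    using True by (simp add: integrable_iff_bounded)
  show ?thesis
    unfolding continuous_on_sequentially comp_def
  proof (intro ballI allI impI, elim conjE)
    fix X :: "nat \<Rightarrow> real ^ 'a" and \<xi>
    assume X: "X \<longlonglongrightarrow> \<xi>"
    show "(\<lambda>n. fourier f (X n)) \<longlonglongrightarrow> fourier f \<xi>"
      unfolding fourier_def
    proof (intro tendsto_mult tendsto_const integral_dominated_convergence[where w = "\<lambda>x. norm (f x)"])
      show "AE x in lborel. (\<lambda>n. exp (- \<i> * of_real (x \<bullet> X n)) * f x) \<longlonglongrightarrow> exp (- \<i> * of_real (x \<bullet> \<xi>)) * f x"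
        by (intro AE_I2 tendsto_intros X)
    qed (use True in \<open>auto simp: norm_mult\<close>)
  qed
next
  case False
  then show ?thesis by (simp add: fourier_not_integrable continuous_on_const cong: continuous_on_cong)
qed

lemma integrable_compactly_supported:
  fixes g :: "real ^ 'n \<Rightarrow> complex"
  assumes cont: "continuous_on UNIV g" and supp: "\<And>\<xi>. norm \<xi> > r \<Longrightarrow> g \<xi> = 0"
  shows "integrable lborel g"
proof -
  have "integrable lborel (\<lambda>x. indicator (cball 0 r) x *\<^sub>R g x)"
    by (rule borel_integrable_compact) (auto intro: continuous_on_subset[OF cont])
  moreover have "(\<lambda>x. indicator (cball 0 r) x *\<^sub>R g x) = g"
    using supp by (force simp: fun_eq_iff indicator_def)
  ultimately show ?thesis by simp
qed

text \<open>
  These symbols localise any Fourier transform to an integrable, bounded and continuous function,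
  to which the results on \<open>inv_fourier\<close> apply.
\<close>

definition compact_multiplier :: "(real ^ 'n \<Rightarrow> complex) \<Rightarrow> bool" where
  "compact_multiplier a \<longleftrightarrow> continuous_on UNIV a \<and> (\<exists>r. \<forall>\<xi>. norm \<xi> > r \<longrightarrow> a \<xi> = 0)"

lemma compact_multiplier_fourier:
  fixes a f :: "real ^ 'n \<Rightarrow> complex"
  assumes a: "compact_multiplier a"
  shows "integrable lborel (\<lambda>\<xi>. a \<xi> * fourier f \<xi>)" and "continuous_on UNIV (\<lambda>\<xi>. a \<xi> * fourier f \<xi>)"
    and "\<exists>B. \<forall>\<xi>. norm (a \<xi> * fourier f \<xi>) \<le> B"
proof -
  show cont: "continuous_on UNIV (\<lambda>\<xi>. a \<xi> * fourier f \<xi>)"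
    using a by (intro continuous_intros continuous_on_fourier) (simp add: compact_multiplier_def)
  obtain r where r: "\<And>\<xi>. norm \<xi> > r \<Longrightarrow> a \<xi> = 0" using a by (auto simp: compact_multiplier_def)
  show "integrable lborel (\<lambda>\<xi>. a \<xi> * fourier f \<xi>)"
    using r by (intro integrable_compactly_supported[OF cont, of r]) simp
  have "bounded ((\<lambda>\<xi>. a \<xi> * fourier f \<xi>) ` cball 0 r)"
    by (intro compact_imp_bounded compact_continuous_image continuous_on_subset[OF cont]) auto
  then obtain B where B: "\<And>\<xi>. norm \<xi> \<le> r \<Longrightarrow> norm (a \<xi> * fourier f \<xi>) \<le> B"
    by (fastforce simp: bounded_iff)
  have "norm (a \<xi> * fourier f \<xi>) \<le> max 0 B" for \<xi>
    using B[of \<xi>] r[of \<xi>] by (cases "norm \<xi> \<le> r") auto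
  then show "\<exists>B. \<forall>\<xi>. norm (a \<xi> * fourier f \<xi>) \<le> B" by blast
qed

lemma weighted_L2_fourier_mult_le:
  fixes a f :: "real ^ 'n \<Rightarrow> complex"
  assumes a: "compact_multiplier a"
  shows "(weighted_L2 lam (fourier_mult a f))\<^sup>2
    \<le> (\<integral>\<^sup>+\<xi>. ennreal (m_symbol lam \<xi> * (norm (a \<xi> * fourier f \<xi>))\<^sup>2) \<partial>lborel)"
proof -
  obtain B where "\<And>\<xi>. norm (a \<xi> * fourier f \<xi>) \<le> B"
    using compact_multiplier_fourier(3)[OF a] by blast
  then have le: "norm (fourier (fourier_mult a f) \<xi>) \<le> norm (a \<xi> * fourier f \<xi>)" for \<xi>
    unfolding fourier_mult_def
    by (intro norm_fourier_inv_fourier_le compact_multiplier_fourier[OF a])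
  have "(weighted_L2 lam (fourier_mult a f))\<^sup>2
      = (\<integral>\<^sup>+\<xi>. ennreal (m_symbol lam \<xi> * (norm (fourier (fourier_mult a f) \<xi>))\<^sup>2) \<partial>lborel)"
    by (simp add: weighted_L2_def L2_norm_on_power2 norm_mult power_mult_distrib m_symbol_def)
  also have "\<dots> \<le> (\<integral>\<^sup>+\<xi>. ennreal (m_symbol lam \<xi> * (norm (a \<xi> * fourier f \<xi>))\<^sup>2) \<partial>lborel)"
    using le by (intro nn_integral_mono ennreal_leI mult_left_mono power_mono) (auto simp: m_symbol_def)
  finally show ?thesis .
qed

text \<open>
  On the shell \<open>D_set j\<close> the Gaussian with \<open>\<sigma> = 2\<^sup>-\<^sup>j\<close> is at least \<open>1 / 2\<close>.  The energy of \<open>inv_fourier g\<close> there is thus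
  controlled by the Schur bound with constant proportional to \<open>1 / (\<tau> \<sigma>) = 2\<^sup>j / \<tau>\<close>, and the factor \<open>2\<^sup>j\<close> is exactly
  what the norm divides by.
\<close>

lemma B_star_norm_inv_fourier_le:
  fixes g :: "real ^ 'n \<Rightarrow> complex" and e :: 'n
  assumes \<tau>: "\<tau> > 0" and d: "CARD('n) \<ge> 2" and g: "integrable lborel g"
  shows "ennreal \<tau> * (B_star_norm (inv_fourier g))\<^sup>2
    \<le> ennreal (300 * real CARD('n) * sqrt CARD('n)) * (\<integral>\<^sup>+\<xi>. ennreal (norm (q_symbol e \<tau> \<xi>) * (norm (g \<xi>))\<^sup>2) \<partial>lborel)"
proof -
  obtain j0 :: 'n where j0: "j0 \<noteq> e"
  proof -
    have "UNIV \<noteq> {e}"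
    proof
      assume "UNIV = {e}"
      then have "CARD('n) = card {e}" by (rule arg_cong)
      with d show False by simp
    qed
    then show ?thesis using that by blast
  qed
  have [measurable]: "g \<in> borel_measurable borel"
    using g by (simp add: integrable_iff_bounded)
  define u where "u = inv_fourier g"
  define I where "I = (\<integral>\<^sup>+\<xi>. ennreal (norm (q_symbol e \<tau> \<xi>) * (norm (g \<xi>))\<^sup>2) \<partial>lborel)"
  define K where "K = 75 * real CARD('n) * sqrt CARD('n)"
  have K: "K \<ge> 0" by (simp add: K_def)
  have [measurable]: "u \<in> borel_measurable borel" unfolding u_def by measurable
  have piece: "(ennreal (2 powr (- real j / 2)) * L2_norm_on (D_set j) u)\<^sup>2 \<le> ennreal (4 * K / \<tau>) * I" for j
  proof -
    define \<sigma> where "\<sigma> = (1 / 2 :: real) ^ j"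
    have \<sigma>: "\<sigma> > 0" by (simp add: \<sigma>_def)
    have "(L2_norm_on (D_set j) u)\<^sup>2 = (\<integral>\<^sup>+x. ennreal ((norm (u x))\<^sup>2) * indicator (D_set j) x \<partial>lborel)"
      by (rule L2_norm_on_power2)
    also have "\<dots> \<le> (\<integral>\<^sup>+x. 2 * ennreal (exp (- (\<sigma> * norm x)\<^sup>2 / 2) * (norm (u x))\<^sup>2) \<partial>lborel)"
    proof (rule nn_integral_mono)
      fix x :: "real ^ 'n"
      show "ennreal ((norm (u x))\<^sup>2) * indicator (D_set j) x \<le> 2 * ennreal (exp (- (\<sigma> * norm x)\<^sup>2 / 2) * (norm (u x))\<^sup>2)"
      proof (cases "x \<in> D_set j")
        case True
        then have "norm x \<le> 2 ^ j" by (auto simp: D_set_def split: if_splits)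
        then have "\<sigma> * norm x \<le> 1" by (simp add: \<sigma>_def field_simps power_divide)
        then have "(\<sigma> * norm x)\<^sup>2 \<le> 1" using \<sigma> by (simp add: power_le_one)
        then have "1 / 2 \<le> 1 + - (\<sigma> * norm x)\<^sup>2 / 2" by simp
        also have "\<dots> \<le> exp (- (\<sigma> * norm x)\<^sup>2 / 2)" by (rule exp_ge_add_one_self)
        finally have "1 * (norm (u x))\<^sup>2 \<le> (2 * exp (- (\<sigma> * norm x)\<^sup>2 / 2)) * (norm (u x))\<^sup>2"
          by (intro mult_right_mono) auto
        then have "ennreal ((norm (u x))\<^sup>2) \<le> ennreal (2 * (exp (- (\<sigma> * norm x)\<^sup>2 / 2) * (norm (u x))\<^sup>2))"
          by (intro ennreal_leI) (simp add: mult_ac)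
        also have "\<dots> = 2 * ennreal (exp (- (\<sigma> * norm x)\<^sup>2 / 2) * (norm (u x))\<^sup>2)"
          by (subst ennreal_mult) auto
        finally show ?thesis using True by simp
      qed simp
    qed
    also have "\<dots> = 2 * (\<integral>\<^sup>+x. ennreal (exp (- (\<sigma> * norm x)\<^sup>2 / 2) * (norm (u x))\<^sup>2) \<partial>lborel)"
      by (rule nn_integral_cmult) measurable
    also have "\<dots> \<le> 2 * (2 * ennreal (K / (\<tau> * \<sigma>)) * I)"
    proof (rule mult_left_mono)
      have "(\<integral>\<^sup>+x. ennreal (exp (- (\<sigma> * norm x)\<^sup>2 / 2) * (norm (u x))\<^sup>2) \<partial>lborel)
          \<le> (\<integral>\<^sup>+\<xi>. \<integral>\<^sup>+\<eta>. ennreal (gauss_kernel \<sigma> (\<xi> - \<eta>) * (norm (g \<xi>) * norm (g \<eta>))) \<partial>lborel \<partial>lborel)"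
        unfolding u_def by (rule gaussian_energy_le[OF \<sigma> g])
      also have "\<dots> \<le> 2 * ennreal (K / (\<tau> * \<sigma>)) * I"
        unfolding I_def K_def using gauss_average_inverse_q_symbol[OF \<tau> \<sigma> j0]
        by (intro weighted_schur_bound \<sigma>) auto
      finally show "(\<integral>\<^sup>+x. ennreal (exp (- (\<sigma> * norm x)\<^sup>2 / 2) * (norm (u x))\<^sup>2) \<partial>lborel)
        \<le> 2 * ennreal (K / (\<tau> * \<sigma>)) * I" .
    qed simp
    also have "\<dots> = ennreal (4 * (K / (\<tau> * \<sigma>))) * I"
      using \<tau> \<sigma> K by (subst ennreal_mult) (simp_all add: mult.assoc[symmetric])
    finally have L2: "(L2_norm_on (D_set j) u)\<^sup>2 \<le> ennreal (4 * (K / (\<tau> * \<sigma>))) * I" .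
    have pow: "(ennreal (2 powr (- real j / 2)))\<^sup>2 = ennreal \<sigma>"
    proof -
      have "(2 powr (- real j / 2))\<^sup>2 = (2 :: real) powr (- real j)"
        by (simp add: power2_eq_square flip: powr_add)
      also have "\<dots> = \<sigma>" by (simp add: \<sigma>_def powr_minus powr_realpow power_one_over inverse_eq_divide)
      finally show ?thesis by (simp add: ennreal_power)
    qed
    have "(ennreal (2 powr (- real j / 2)) * L2_norm_on (D_set j) u)\<^sup>2
        \<le> ennreal \<sigma> * (ennreal (4 * (K / (\<tau> * \<sigma>))) * I)"
      unfolding power_mult_distrib pow by (intro mult_left_mono L2) simp
    also have "\<dots> = ennreal (\<sigma> * (4 * (K / (\<tau> * \<sigma>)))) * I"
      using \<tau> \<sigma> K by (subst ennreal_mult[of \<sigma>]) (simp_all add: mult.assoc)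
    also have "\<sigma> * (4 * (K / (\<tau> * \<sigma>))) = 4 * K / \<tau>" using \<sigma> by simp
    finally show ?thesis .
  qed
  have "B_star_norm u \<le> ennsqrt (ennreal (4 * K / \<tau>) * I)"
    unfolding B_star_norm_def
    by (intro SUP_least) (metis ennsqrt_mono ennsqrt_of_power2 piece)
  then have "(B_star_norm u)\<^sup>2 \<le> ennreal (4 * K / \<tau>) * I"
    by (metis ennsqrt_power2 power_mono zero_le)
  then have "ennreal \<tau> * (B_star_norm u)\<^sup>2 \<le> ennreal \<tau> * (ennreal (4 * K / \<tau>) * I)"
    by (rule mult_left_mono) simp
  also have "\<dots> = ennreal (\<tau> * (4 * K / \<tau>)) * I"
    using \<tau> K by (subst ennreal_mult[of \<tau>]) (simp_all add: mult.assoc)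
  also have "\<tau> * (4 * K / \<tau>) = 300 * real CARD('n) * sqrt CARD('n)" using \<tau> by (simp add: K_def)
  finally show ?thesis unfolding u_def I_def .
qed

section \<open>Littlewood--Paley cutoffs\<close>

lemma LP_cutoff_bound:
  assumes "LP_cutoff \<phi>"
  obtains B where "B > 0" "\<And>\<xi>. norm (\<phi> \<xi>) \<le> B"
proof -
  have "\<exists>B. \<forall>\<xi>. norm (\<phi> \<xi>) \<le> B"
    using assms unfolding LP_cutoff_def schwartz_space_def
    by (force simp: iter_partial_def dest: spec[of _ "[]"] spec[of _ "0::nat"])
  then obtain B where "\<And>\<xi>. norm (\<phi> \<xi>) \<le> B" by blast
  then show ?thesis using that[of "max 1 B"] by (force simp: le_max_iff_disj)
qed

lemma LP_cutoff_continuous: "LP_cutoff \<phi> \<Longrightarrow> continuous_on UNIV \<phi>"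
  unfolding LP_cutoff_def schwartz_space_def
  by (force simp: iter_partial_def continuous_on_eq_continuous_at
      intro: differentiable_imp_continuous_within dest: spec[of _ "[]"])

lemma LP_cutoff_eq_0: "LP_cutoff \<phi> \<Longrightarrow> norm \<xi> > 2 \<Longrightarrow> \<phi> \<xi> = 0"
  unfolding LP_cutoff_def using closure_subset[of "{\<xi>. \<phi> \<xi> \<noteq> 0}"] by force

lemma LP_psi_norm_le:
  assumes "\<And>\<xi>. norm (\<phi> \<xi>) \<le> B"
  shows "norm (LP_psi \<phi> \<xi>) \<le> 2 * B"
  unfolding LP_psi_def using norm_triangle_ineq4[of "\<phi> \<xi>" "\<phi> (2 *\<^sub>R \<xi>)"] assms[of \<xi>] assms[of "2 *\<^sub>R \<xi>"]
  by linarith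

lemma LP_psi_eq_0:
  assumes "LP_cutoff \<phi>" "norm \<xi> \<le> 1 / 2 \<or> norm \<xi> > 2"
  shows "LP_psi \<phi> \<xi> = 0"
  using assms(2)
proof
  assume "norm \<xi> \<le> 1 / 2"
  then show ?thesis using assms(1) by (simp add: LP_psi_def LP_cutoff_def)
next
  assume "norm \<xi> > 2"
  then show ?thesis
    using LP_cutoff_eq_0[OF assms(1)] by (simp add: LP_psi_def)
qed

lemma compact_multiplier_rescale:
  assumes cont: "continuous_on UNIV a"
    and supp: "\<And>\<xi>. norm \<xi> > 2 \<Longrightarrow> a \<xi> = 0" and s: "s > 0"
  shows "compact_multiplier (\<lambda>\<xi>. a (\<xi> /\<^sub>R s))"
  unfolding compact_multiplier_def
proof (intro conjI exI allI impI)
  show "continuous_on UNIV (\<lambda>\<xi>. a (\<xi> /\<^sub>R s))"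
    by (intro continuous_on_compose2[OF cont] continuous_intros) auto
  show "a (\<xi> /\<^sub>R s) = 0" if "norm \<xi> > 2 * s" for \<xi>
    using that s by (intro supp) (simp add: field_simps)
qed

lemma LP_psi_compact_multiplier:
  assumes \<phi>: "LP_cutoff \<phi>"
  shows "compact_multiplier (\<lambda>\<xi>. LP_psi \<phi> (\<xi> /\<^sub>R 2 powi k))"
proof -
  have "continuous_on UNIV (LP_psi \<phi>)"
    unfolding LP_psi_def
    by (intro continuous_on_diff continuous_on_compose2[OF LP_cutoff_continuous[OF \<phi>]] continuous_intros) auto
  then show ?thesis
    by (rule compact_multiplier_rescale) (auto intro: LP_psi_eq_0[OF \<phi>])
qed

text \<open>
  The \<open>k\<close>-th cutoff vanishes at \<open>\<xi>\<close> unless \<open>2\<^sup>k\<^sup>-\<^sup>1 < \<bar>\<xi>\<bar> \<le> 2\<^sup>k\<^sup>+\<^sup>1\<close>, which confines \<open>k\<close> to three consecutive integers.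
\<close>

lemma LP_psi_overlap:
  fixes \<phi> :: "real ^ 'n \<Rightarrow> complex"
  assumes \<phi>: "LP_cutoff \<phi>" and B: "\<And>\<xi>. norm (\<phi> \<xi>) \<le> B" and F: "finite F"
  shows "(\<Sum>k\<in>F. (norm (LP_psi \<phi> (\<xi> /\<^sub>R 2 powi k)))\<^sup>2) \<le> 3 * (2 * B)\<^sup>2"
proof -
  define L where "L = log 2 (norm \<xi>)"
  define G where "G = {k \<in> F. LP_psi \<phi> (\<xi> /\<^sub>R 2 powi k) \<noteq> 0}"
  have sub: "G \<subseteq> {\<lceil>L\<rceil> - 1 .. \<lceil>L\<rceil> + 1}"
  proof
    fix k assume "k \<in> G"
    then have "\<not> (norm (\<xi> /\<^sub>R 2 powi k) \<le> 1 / 2 \<or> norm (\<xi> /\<^sub>R 2 powi k) > 2)"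
      using LP_psi_eq_0[OF \<phi>] by (auto simp: G_def)
    then have lo: "2 powi k / 2 < norm \<xi>" and hi: "norm \<xi> \<le> 2 * 2 powi k"
      by (simp_all add: field_simps)
    have p: "2 powi k = 2 powr real_of_int k" by (simp add: powr_real_of_int')
    have pos: "norm \<xi> > 0" using lo by (smt (verit) divide_pos_pos zero_less_power_int)
    have "2 powr (real_of_int k - 1) < norm \<xi>" using lo by (simp add: p powr_diff)
    then have "real_of_int k - 1 < L" using pos by (simp add: L_def less_log_iff)
    moreover have "norm \<xi> \<le> 2 powr (real_of_int k + 1)" using hi by (simp add: p powr_add)
    then have "L \<le> real_of_int k + 1" using pos by (simp add: L_def log_le_iff)
    ultimately show "k \<in> {\<lceil>L\<rceil> - 1 .. \<lceil>L\<rceil> + 1}"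
      by (auto simp: le_ceiling_iff ceiling_le_iff) linarith+
  qed
  have "card G \<le> card {\<lceil>L\<rceil> - 1 .. \<lceil>L\<rceil> + 1}" by (intro card_mono sub) simp
  then have card: "card G \<le> 3" by simp
  have "(\<Sum>k\<in>F. (norm (LP_psi \<phi> (\<xi> /\<^sub>R 2 powi k)))\<^sup>2) = (\<Sum>k\<in>G. (norm (LP_psi \<phi> (\<xi> /\<^sub>R 2 powi k)))\<^sup>2)"
    using F by (intro sum.mono_neutral_right) (auto simp: G_def)
  also have "\<dots> \<le> (\<Sum>k\<in>G. (2 * B)\<^sup>2)"
    by (intro sum_mono power_mono LP_psi_norm_le B) auto
  also have "\<dots> \<le> 3 * (2 * B)\<^sup>2" using card by (simp add: mult_right_mono)
  finally show ?thesis .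
qed

lemma infsum_weighted_L2_LP_proj_le:
  fixes \<phi> f :: "real ^ 'n \<Rightarrow> complex"
  assumes \<phi>: "LP_cutoff \<phi>" and B: "\<And>\<xi>. norm (\<phi> \<xi>) \<le> B"
  shows "(\<Sum>\<^sub>\<infinity>k\<in>A. (weighted_L2 lam (LP_proj \<phi> k f))\<^sup>2)
    \<le> ennreal (3 * (2 * B)\<^sup>2) * (\<integral>\<^sup>+\<xi>. ennreal (m_symbol lam \<xi> * (norm (fourier f \<xi>))\<^sup>2) \<partial>lborel)"
proof (rule infsum_le_finite_sums)
  fix F :: "int set" assume F: "finite F" "F \<subseteq> A"
  have [measurable]: "fourier f \<in> borel_measurable borel"
    by (intro borel_measurable_continuous_onI continuous_on_fourier)
  have cm: "compact_multiplier (\<lambda>\<xi>. LP_psi \<phi> (\<xi> /\<^sub>R 2 powi k))" for k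
    by (rule LP_psi_compact_multiplier[OF \<phi>])
  have [measurable]: "(\<lambda>\<xi>. LP_psi \<phi> (\<xi> /\<^sub>R 2 powi k)) \<in> borel_measurable borel" for k
    using cm[of k] by (intro borel_measurable_continuous_onI) (simp add: compact_multiplier_def)
  have [measurable]: "m_symbol lam \<in> borel_measurable (borel :: (real ^ 'n) measure)"
    unfolding m_symbol_def by measurable
  let ?h = "\<lambda>k \<xi>. m_symbol lam \<xi> * (norm (LP_psi \<phi> (\<xi> /\<^sub>R 2 powi k) * fourier f \<xi>))\<^sup>2"
  have "(\<Sum>k\<in>F. (weighted_L2 lam (LP_proj \<phi> k f))\<^sup>2) \<le> (\<Sum>k\<in>F. \<integral>\<^sup>+\<xi>. ennreal (?h k \<xi>) \<partial>lborel)"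
    unfolding LP_proj_def by (intro sum_mono weighted_L2_fourier_mult_le cm)
  also have "\<dots> = (\<integral>\<^sup>+\<xi>. (\<Sum>k\<in>F. ennreal (?h k \<xi>)) \<partial>lborel)"
    by (rule nn_integral_sum[symmetric]) measurable
  also have "\<dots> \<le> (\<integral>\<^sup>+\<xi>. ennreal (3 * (2 * B)\<^sup>2) * ennreal (m_symbol lam \<xi> * (norm (fourier f \<xi>))\<^sup>2) \<partial>lborel)"
  proof (rule nn_integral_mono)
    fix \<xi> :: "real ^ 'n"
    have "(\<Sum>k\<in>F. ennreal (?h k \<xi>)) = ennreal (\<Sum>k\<in>F. ?h k \<xi>)"
      by (intro sum_ennreal) (simp add: m_symbol_def)
    also have "(\<Sum>k\<in>F. ?h k \<xi>) = (\<Sum>k\<in>F. (norm (LP_psi \<phi> (\<xi> /\<^sub>R 2 powi k)))\<^sup>2) * (m_symbol lam \<xi> * (norm (fourier f \<xi>))\<^sup>2)"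
      unfolding sum_distrib_right by (intro sum.cong) (simp_all add: norm_mult power_mult_distrib)
    also have "ennreal \<dots> \<le> ennreal (3 * (2 * B)\<^sup>2 * (m_symbol lam \<xi> * (norm (fourier f \<xi>))\<^sup>2))"
      by (intro ennreal_leI mult_right_mono LP_psi_overlap[OF \<phi> B] F) (simp add: m_symbol_def)
    also have "\<dots> = ennreal (3 * (2 * B)\<^sup>2) * ennreal (m_symbol lam \<xi> * (norm (fourier f \<xi>))\<^sup>2)"
      by (rule ennreal_mult) (auto simp: m_symbol_def)
    finally show "(\<Sum>k\<in>F. ennreal (?h k \<xi>)) \<le> ennreal (3 * (2 * B)\<^sup>2) * ennreal (m_symbol lam \<xi> * (norm (fourier f \<xi>))\<^sup>2)" .
  qed
  also have "\<dots> = ennreal (3 * (2 * B)\<^sup>2) * (\<integral>\<^sup>+\<xi>. ennreal (m_symbol lam \<xi> * (norm (fourier f \<xi>))\<^sup>2) \<partial>lborel)"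
    by (rule nn_integral_cmult) measurable
  finally show "(\<Sum>k\<in>F. (weighted_L2 lam (LP_proj \<phi> k f))\<^sup>2)
    \<le> ennreal (3 * (2 * B)\<^sup>2) * (\<integral>\<^sup>+\<xi>. ennreal (m_symbol lam \<xi> * (norm (fourier f \<xi>))\<^sup>2) \<partial>lborel)" .
qed (rule nonneg_summable_on_complete, simp)

text \<open>
  The four middle frequencies enter with the factor \<open>sqrt \<lambda> = \<tau>\<close>, which cancels the \<open>1 / \<tau>\<close>
  in the local energy bound; so the resulting constant depends only on the dimension and on \<open>\<phi>\<close>.
\<close>

theorem lemma4p18:
  fixes \<phi> :: "real ^ 'n \<Rightarrow> complex" and e :: 'n
  assumes "CARD('n) \<ge> 3" and "LP_cutoff \<phi>"
  shows "\<exists>C::real. C > 0 \<and> (\<forall>\<tau>::real. \<forall>lam::real. \<tau> > 0 \<longrightarrow> lam = \<tau>\<^sup>2 \<longrightarrow>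
    (\<forall>f \<in> schwartz_space. Y_star_norm \<phi> lam f \<le> ennreal C * Ydot_norm e (1/2) \<tau> f))"
proof -
  obtain B where B0: "B > 0" and B: "\<And>\<xi>. norm (\<phi> \<xi>) \<le> B"
    using LP_cutoff_bound[OF assms(2)] by blast
  define K where "K = 300 * real CARD('n) * sqrt CARD('n)"
  have K: "K > 0" by (simp add: K_def)
  define c where "c = B\<^sup>2 + 4 * (K * (2 * B)\<^sup>2) + 3 * (2 * B)\<^sup>2"
  have c: "c > 0" using B0 K by (simp add: c_def add_pos_pos)
  have "Y_star_norm \<phi> lam f \<le> ennreal (sqrt c) * Ydot_norm e (1/2) \<tau> f"
    if \<tau>: "\<tau> > 0" and lam: "lam = \<tau>\<^sup>2" for \<tau> lam :: real and f
  proof -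
    have [measurable]: "fourier f \<in> borel_measurable borel"
      by (intro borel_measurable_continuous_onI continuous_on_fourier)
    define I where "I = (\<integral>\<^sup>+\<xi>. ennreal (norm (q_symbol e \<tau> \<xi>) * (norm (fourier f \<xi>))\<^sup>2) \<partial>lborel)"
    have Ydot: "Ydot_norm e (1/2) \<tau> f = ennsqrt I"
      by (simp add: Ydot_norm_def L2_norm_on_def I_def norm_mult power_mult_distrib powr_half_sqrt)
    have mult_le: "(\<integral>\<^sup>+\<xi>. ennreal (w \<xi> * (norm (a \<xi> * fourier f \<xi>))\<^sup>2) \<partial>lborel) \<le> ennreal (A\<^sup>2) * I"
      if "\<And>\<xi>. norm (a \<xi>) \<le> A" "\<And>\<xi>. w \<xi> \<le> norm (q_symbol e \<tau> \<xi>)" for a w A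
    proof -
      have "(\<integral>\<^sup>+\<xi>. ennreal (w \<xi> * (norm (a \<xi> * fourier f \<xi>))\<^sup>2) \<partial>lborel)
          \<le> (\<integral>\<^sup>+\<xi>. ennreal (A\<^sup>2) * ennreal (norm (q_symbol e \<tau> \<xi>) * (norm (fourier f \<xi>))\<^sup>2) \<partial>lborel)"
      proof (rule nn_integral_mono)
        fix \<xi> :: "real ^ 'n"
        have "w \<xi> * (norm (a \<xi> * fourier f \<xi>))\<^sup>2 \<le> norm (q_symbol e \<tau> \<xi>) * (A * norm (fourier f \<xi>))\<^sup>2"
          unfolding norm_mult by (intro mult_mono that power_mono mult_right_mono) auto
        then show "ennreal (w \<xi> * (norm (a \<xi> * fourier f \<xi>))\<^sup>2)
            \<le> ennreal (A\<^sup>2) * ennreal (norm (q_symbol e \<tau> \<xi>) * (norm (fourier f \<xi>))\<^sup>2)"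
          by (simp add: power_mult_distrib mult_ac flip: ennreal_mult)
      qed
      then show ?thesis by (simp add: nn_integral_cmult I_def)
    qed
    have m: "m_symbol lam \<xi> \<le> norm (q_symbol e \<tau> \<xi>)" for \<xi> :: "real ^ 'n"
      using norm_q_symbol_bounds(1)[of \<tau> \<xi> e] by (simp add: m_symbol_def lam)
    define \<kappa> where "\<kappa> = k_index lam"
    have low: "(weighted_L2 lam (LP_proj_le \<phi> (\<kappa> - 3) f))\<^sup>2 \<le> ennreal (B\<^sup>2) * I"
      unfolding LP_proj_le_def
      by (rule order_trans[OF weighted_L2_fourier_mult_le mult_le])
         (auto intro!: compact_multiplier_rescale LP_cutoff_continuous LP_cutoff_eq_0 assms(2) B m)
    have mid: "ennreal (sqrt lam) * (B_star_norm (LP_proj \<phi> k f))\<^sup>2 \<le> ennreal (K * (2 * B)\<^sup>2) * I" for k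
    proof -
      have "ennreal \<tau> * (B_star_norm (LP_proj \<phi> k f))\<^sup>2
          \<le> ennreal K * (\<integral>\<^sup>+\<xi>. ennreal (norm (q_symbol e \<tau> \<xi>) * (norm (LP_psi \<phi> (\<xi> /\<^sub>R 2 powi k) * fourier f \<xi>))\<^sup>2) \<partial>lborel)"
        unfolding LP_proj_def fourier_mult_def K_def using assms(1)
        by (intro B_star_norm_inv_fourier_le \<tau> compact_multiplier_fourier(1) LP_psi_compact_multiplier assms(2)) simp
      also have "\<dots> \<le> ennreal K * (ennreal ((2 * B)\<^sup>2) * I)"
        by (intro mult_left_mono mult_le LP_psi_norm_le B) auto
      also have "\<dots> = ennreal (K * (2 * B)\<^sup>2) * I"
        using K by (subst ennreal_mult) (auto simp: mult.assoc)
      finally show ?thesis using \<tau> by (simp add: lam)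
    qed
    have high: "(\<Sum>\<^sub>\<infinity>k\<in>{\<kappa> + 1<..}. (weighted_L2 lam (LP_proj \<phi> k f))\<^sup>2) \<le> ennreal (3 * (2 * B)\<^sup>2) * I"
    proof -
      have "(\<Sum>\<^sub>\<infinity>k\<in>{\<kappa> + 1<..}. (weighted_L2 lam (LP_proj \<phi> k f))\<^sup>2)
          \<le> ennreal (3 * (2 * B)\<^sup>2) * (\<integral>\<^sup>+\<xi>. ennreal (m_symbol lam \<xi> * (norm (fourier f \<xi>))\<^sup>2) \<partial>lborel)"
        by (rule infsum_weighted_L2_LP_proj_le[OF assms(2) B])
      also have "\<dots> \<le> ennreal (3 * (2 * B)\<^sup>2) * I"
        unfolding I_def by (intro mult_left_mono nn_integral_mono ennreal_leI mult_right_mono m) auto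
      finally show ?thesis .
    qed
    have "(weighted_L2 lam (LP_proj_le \<phi> (\<kappa> - 3) f))\<^sup>2 +
        (\<Sum>k\<in>{\<kappa> - 2, \<kappa> - 1, \<kappa>, \<kappa> + 1}. ennreal (sqrt lam) * (B_star_norm (LP_proj \<phi> k f))\<^sup>2) +
        (\<Sum>\<^sub>\<infinity>k\<in>{\<kappa> + 1<..}. (weighted_L2 lam (LP_proj \<phi> k f))\<^sup>2)
      \<le> ennreal (B\<^sup>2) * I + (\<Sum>k\<in>{\<kappa> - 2, \<kappa> - 1, \<kappa>, \<kappa> + 1}. ennreal (K * (2 * B)\<^sup>2) * I)
          + ennreal (3 * (2 * B)\<^sup>2) * I"
      by (intro add_mono low high sum_mono mid)
    also have "(\<Sum>k\<in>{\<kappa> - 2, \<kappa> - 1, \<kappa>, \<kappa> + 1}. ennreal (K * (2 * B)\<^sup>2) * I) = ennreal (4 * (K * (2 * B)\<^sup>2)) * I"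
      using K by (subst ennreal_mult) (auto simp: mult.assoc)
    also have "ennreal (B\<^sup>2) * I + ennreal (4 * (K * (2 * B)\<^sup>2)) * I + ennreal (3 * (2 * B)\<^sup>2) * I = ennreal c * I"
    proof -
      have "ennreal c = ennreal (B\<^sup>2) + ennreal (4 * (K * (2 * B)\<^sup>2)) + ennreal (3 * (2 * B)\<^sup>2)"
        unfolding c_def using K by (subst ennreal_plus, simp, simp, subst ennreal_plus) simp_all
      then show ?thesis by (simp only: distrib_right)
    qed
    finally have "Y_star_norm \<phi> lam f \<le> ennsqrt (ennreal c * I)"
      unfolding Y_star_norm_def \<kappa>_def Let_def by (rule ennsqrt_mono)
    then show ?thesis by (simp add: Ydot ennsqrt_cmult[OF c])
  qed
  moreover have "sqrt c > 0" using c by simp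
  ultimately show ?thesis by blast
qed

end
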